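(* Let $R$ be a centrally essential ring with center $C$. **1.** If $C$ is a semiprime ring, then the ring $R$ is commutative. **2.** If the ring $R$ is semiprime, then $R$ is commutative. **3.** In the ring $R$, all idempotents are central. **4.** If the ring $R$ is semiperfect, then $R/J(R)$ is a finite direct product of fields; in particular, $R/J(R)$ is a commutative ring. In addition, $R$ is a finite direct product of centrally essential local rings, and $\mathrm{Soc}(R_C)\subseteq C$.
   Context: All rings are associative and unital (not necessarily commutative). $J(R)$ denotes the Jacobson radical of $R$. A ring $R$ with center $C$ is *centrally essential* if the module $R_C$ ($R$ regarded as a module over its center $C$) is an essential extension of $C_C$, i.e. every nonzero $C$-submodule of $R$ meets $C$ nontrivially; equivalently, for every $r\in R\setminus\{0\}$ there exists $c\in C$ with $rc\in C\setminus\{0\}$. A ring $R$ is *local* if $R/J(R)$ is a division ring. A ring $R$ is *semiperfect* if $R/J(R)$ is an Artinian ring and every complete system of orthogonal idempotents of $R/J(R)$ can be lifted to a complete system of orthogonal idempotents of $R$. For a module $M$, the socle $\mathrm{Soc}(M)$ is the sum of all simple submodules of $M$, and $\mathrm{Soc}(M)=0$ if $M$ has no simple submodules. $\mathrm{Soc}(R_C)$ is the socle of $R$ regarded as a $C$-module. *)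

theory Defs
  imports "HOL-Algebra.Algebra"
begin

text \<open>Rings are those of the locale \<^locale>\<open>ring\<close>: associative and unital, not necessarily
  commutative; the zero ring is not excluded.\<close>


section \<open>Modules: essential submodules and the socle\<close>

definition essential_submodule :: "'b set \<Rightarrow> ('a, 'c) ring_scheme \<Rightarrow> ('a, 'b, 'd) module_scheme \<Rightarrow> bool"
  where "essential_submodule N A M \<longleftrightarrow>
    submodule N A M \<and>
    (\<forall>H. submodule H A M \<and> H \<noteq> {\<zero>\<^bsub>M\<^esub>} \<longrightarrow> H \<inter> N \<noteq> {\<zero>\<^bsub>M\<^esub>})"

definition simple_submodule :: "'b set \<Rightarrow> ('a, 'c) ring_scheme \<Rightarrow> ('a, 'b, 'd) module_scheme \<Rightarrow> bool"
  where "simple_submodule N A M \<longleftrightarrow>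
    submodule N A M \<and> N \<noteq> {\<zero>\<^bsub>M\<^esub>} \<and>
    (\<forall>H. submodule H A M \<and> H \<subseteq> N \<longrightarrow> H = {\<zero>\<^bsub>M\<^esub>} \<or> H = N)"

text \<open>The sum of a family of submodules is the additive subgroup generated by their union; for the
  empty family this is the zero submodule.\<close>

definition socle :: "('a, 'c) ring_scheme \<Rightarrow> ('a, 'b, 'd) module_scheme \<Rightarrow> 'b set"
  where "socle A M = generate (add_monoid M) (\<Union>{N. simple_submodule N A M})"


section \<open>The center and centrally essential rings\<close>

definition center :: "('a, 'b) ring_scheme \<Rightarrow> 'a set"
  where "center R = {c \<in> carrier R. \<forall>r \<in> carrier R. c \<otimes>\<^bsub>R\<^esub> r = r \<otimes>\<^bsub>R\<^esub> c}"

abbreviation center_ring :: "('a, 'b) ring_scheme \<Rightarrow> ('a, 'b) ring_scheme"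
  where "center_ring R \<equiv> R\<lparr>carrier := center R\<rparr>"

text \<open>The right module \<open>R\<^sub>C\<close>. The locale \<^locale>\<open>module\<close> writes scalars on the left, which is
  harmless because \<open>C\<close> is commutative.\<close>

definition center_module :: "('a, 'b) ring_scheme \<Rightarrow> ('a, 'a) module"
  where "center_module R =
    \<lparr>carrier = carrier R, monoid.mult = (\<otimes>\<^bsub>R\<^esub>), one = \<one>\<^bsub>R\<^esub>,
     ring.zero = \<zero>\<^bsub>R\<^esub>, add = (\<oplus>\<^bsub>R\<^esub>),
     smult = (\<lambda>c r. r \<otimes>\<^bsub>R\<^esub> c)\<rparr>"

locale centrally_essential_ring = ring +
  assumes center_essential: "essential_submodule (center R) (center_ring R) (center_module R)"


section \<open>One-sided ideals, Jacobson radical, Artinian rings\<close>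

locale right_ideal = additive_subgroup I R + ring R for I and R (structure) +
  assumes I_r_closed: "\<lbrakk>a \<in> I; x \<in> carrier R\<rbrakk> \<Longrightarrow> a \<otimes> x \<in> I"

locale left_ideal = additive_subgroup I R + ring R for I and R (structure) +
  assumes I_l_closed: "\<lbrakk>a \<in> I; x \<in> carrier R\<rbrakk> \<Longrightarrow> x \<otimes> a \<in> I"

locale maximal_right_ideal = right_ideal +
  assumes I_notcarr: "carrier R \<noteq> I"
    and I_maximal: "\<lbrakk>right_ideal J R; I \<subseteq> J; J \<subseteq> carrier R\<rbrakk> \<Longrightarrow> J = I \<or> J = carrier R"

text \<open>The intersection with the carrier matters only for the zero ring, which has no maximal
  right ideals.\<close>

definition jacobson_radical :: "('a, 'b) ring_scheme \<Rightarrow> 'a set"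
  where "jacobson_radical R = carrier R \<inter> \<Inter>{I. maximal_right_ideal I R}"

locale artinian_ring = ring +
  assumes right_dcc: "\<lbrakk>\<And>n::nat. right_ideal (I n) R; \<And>n. I (Suc n) \<subseteq> I n\<rbrakk> \<Longrightarrow> \<exists>n. \<forall>m\<ge>n. I m = I n"
    and left_dcc: "\<lbrakk>\<And>n::nat. left_ideal (I n) R; \<And>n. I (Suc n) \<subseteq> I n\<rbrakk> \<Longrightarrow> \<exists>n. \<forall>m\<ge>n. I m = I n"


section \<open>Semiprime, local and semiperfect rings\<close>

definition nilpotent_ideal :: "'a set \<Rightarrow> ('a, 'b) ring_scheme \<Rightarrow> bool"
  where "nilpotent_ideal I R \<longleftrightarrow> ideal I R \<and> (\<exists>n::nat. I [^]\<^bsub>ideals_set R\<^esub> n = {\<zero>\<^bsub>R\<^esub>})"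

locale semiprime_ring = ring +
  assumes nilpotent_ideal_zero: "nilpotent_ideal I R \<Longrightarrow> I = {\<zero>}"

locale division_ring = ring +
  assumes one_not_zero: "\<one> \<noteq> \<zero>"
    and nonzero_Units: "Units R = carrier R - {\<zero>}"

locale local_ring = ring +
  assumes quotient_division_ring: "division_ring (R Quot jacobson_radical R)"

definition idempotent_elem :: "('a, 'b) ring_scheme \<Rightarrow> 'a \<Rightarrow> bool"
  where "idempotent_elem R e \<longleftrightarrow> e \<in> carrier R \<and> e \<otimes>\<^bsub>R\<^esub> e = e"

definition complete_orthogonal_idempotents :: "('a, 'b) ring_scheme \<Rightarrow> nat \<Rightarrow> (nat \<Rightarrow> 'a) \<Rightarrow> bool"
  where "complete_orthogonal_idempotents R n e \<longleftrightarrow>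
    (\<forall>i<n. idempotent_elem R (e i)) \<and>
    (\<forall>i<n. \<forall>j<n. i \<noteq> j \<longrightarrow> e i \<otimes>\<^bsub>R\<^esub> e j = \<zero>\<^bsub>R\<^esub>) \<and>
    finsum R e {..<n} = \<one>\<^bsub>R\<^esub>"

locale semiperfect_ring = ring +
  assumes quotient_artinian: "artinian_ring (R Quot jacobson_radical R)"
    and idempotents_lift: "complete_orthogonal_idempotents (R Quot jacobson_radical R) n e \<Longrightarrow>
      \<exists>f. complete_orthogonal_idempotents R n f \<and> (\<forall>i<n. jacobson_radical R +> f i = e i)"


section \<open>Basic facts\<close>

lemma (in ring) center_in_carrier: "center R \<subseteq> carrier R"
  by (auto simp: center_def)

lemma (in ring) center_subcring: "subcring (center R) R"
proof (intro subcringI subringI)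
  show "center R \<subseteq> carrier R"
    by (rule center_in_carrier)
  show "\<one> \<in> center R"
    by (simp add: center_def)
  show "\<ominus> h \<in> center R" if "h \<in> center R" for h
    using that by (simp add: center_def l_minus r_minus)
  show "h1 \<otimes> h2 \<in> center R" if "h1 \<in> center R" "h2 \<in> center R" for h1 h2
  proof -
    have "h1 \<otimes> h2 \<otimes> r = r \<otimes> (h1 \<otimes> h2)" if r: "r \<in> carrier R" for r
    proof -
      have h: "h1 \<in> carrier R" "h2 \<in> carrier R" "h1 \<otimes> r = r \<otimes> h1" "h2 \<otimes> r = r \<otimes> h2"
        using \<open>h1 \<in> center R\<close> \<open>h2 \<in> center R\<close> r by (auto simp: center_def)
      have "h1 \<otimes> h2 \<otimes> r = h1 \<otimes> (r \<otimes> h2)"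
        using h r by (simp add: m_assoc)
      also have "\<dots> = r \<otimes> h1 \<otimes> h2"
        using h r by (simp add: m_assoc[symmetric])
      finally show ?thesis
        using h r by (simp add: m_assoc)
    qed
    moreover have "h1 \<otimes> h2 \<in> carrier R"
      using that center_in_carrier by blast
    ultimately show ?thesis
      unfolding center_def by blast
  qed
  show "h1 \<oplus> h2 \<in> center R" if "h1 \<in> center R" "h2 \<in> center R" for h1 h2
    using that by (simp add: center_def l_distr r_distr)
  show "h1 \<otimes> h2 = h2 \<otimes> h1" if "h1 \<in> center R" "h2 \<in> center R" for h1 h2
    using that unfolding center_def by blast
qed

lemma (in ring) center_ring_cring: "cring (center_ring R)"
  using center_subcring subcring_iff[OF center_in_carrier] by simp

lemma (in ring) center_module_module: "module (center_ring R) (center_module R)"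
proof (rule moduleI)
  have carr: "c \<in> carrier R" if "c \<in> center R" for c
    using that center_in_carrier by blast
  show "cring (center_ring R)"
    by (rule center_ring_cring)
  show "abelian_group (center_module R)"
  proof (rule abelian_groupI)
    fix x assume "x \<in> carrier (center_module R)"
    then have "\<ominus> x \<in> carrier R" "\<ominus> x \<oplus> x = \<zero>"
      by (simp_all add: center_module_def l_neg)
    then show "\<exists>y\<in>carrier (center_module R). y \<oplus>\<^bsub>center_module R\<^esub> x = \<zero>\<^bsub>center_module R\<^esub>"
      unfolding center_module_def by (simp only: module.simps ring.simps partial_object.simps monoid.simps) blast
  qed (simp_all add: center_module_def a_ac)
  fix a b x
  assume "a \<in> carrier (center_ring R)" "b \<in> carrier (center_ring R)" "x \<in> carrier (center_module R)"
  then have abx: "a \<in> center R" "b \<in> center R" "a \<in> carrier R" "b \<in> carrier R" "x \<in> carrier R"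
    using carr by (simp_all add: center_module_def)
  have "x \<otimes> (a \<otimes> b) = x \<otimes> (b \<otimes> a)"
    using subcringE(8)[OF center_subcring] abx by metis
  also have "\<dots> = x \<otimes> b \<otimes> a"
    using abx by (simp add: m_assoc)
  finally show "(a \<otimes>\<^bsub>center_ring R\<^esub> b) \<odot>\<^bsub>center_module R\<^esub> x = a \<odot>\<^bsub>center_module R\<^esub> (b \<odot>\<^bsub>center_module R\<^esub> x)"
    by (simp add: center_module_def)
qed (use center_in_carrier in \<open>auto simp: center_module_def l_distr r_distr subset_eq\<close>)

lemma (in ring) submodule_center_module_iff:
  "submodule H (center_ring R) (center_module R) \<longleftrightarrow>
     subgroup H (add_monoid R) \<and> (\<forall>c \<in> center R. \<forall>x \<in> H. x \<otimes> c \<in> H)"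
  by (auto simp: submodule_def submodule_axioms_def center_module_def subgroup_def m_inv_def)

lemma (in ring) centrally_essential_ring_iff:
  "centrally_essential_ring R \<longleftrightarrow>
     (\<forall>r \<in> carrier R - {\<zero>}. \<exists>c \<in> center R. r \<otimes> c \<in> center R - {\<zero>})"
    (is "_ \<longleftrightarrow> ?elementwise")
proof
  assume "centrally_essential_ring R"
  then have ess: "H \<inter> center R \<noteq> {\<zero>}"
    if "submodule H (center_ring R) (center_module R)" "H \<noteq> {\<zero>}" for H
    using that unfolding centrally_essential_ring_def centrally_essential_ring_axioms_def
      essential_submodule_def by (auto simp: center_module_def)
  note C = subcringE[OF center_subcring]
  show ?elementwise
  proof
    fix r assume r: "r \<in> carrier R - {\<zero>}"
    let ?H = "(\<lambda>c. r \<otimes> c) ` center R"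
    have carr: "c \<in> carrier R" if "c \<in> center R" for c
      using that center_in_carrier by blast
    have zero: "\<zero> \<in> ?H"
      using r C(2) by (intro image_eqI[of _ _ \<zero>]) auto
    have "subgroup ?H (add_monoid R)"
    proof (rule add.subgroupI)
      show "?H \<subseteq> carrier R"
        using r carr by auto
      show "?H \<noteq> {}"
        using zero by blast
      show "\<ominus> a \<in> ?H" if "a \<in> ?H" for a
      proof -
        from that obtain c where c: "c \<in> center R" "a = r \<otimes> c" by blast
        then have "\<ominus> a = r \<otimes> \<ominus> c"
          using r carr by (simp add: r_minus)
        then show ?thesis
          using C(5) c by blast
      qed
      show "a \<oplus> b \<in> ?H" if ab: "a \<in> ?H" "b \<in> ?H" for a b
      proof -
        from ab obtain c d where c: "c \<in> center R" "a = r \<otimes> c" and d: "d \<in> center R" "b = r \<otimes> d"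
          by blast
        then have "a \<oplus> b = r \<otimes> (c \<oplus> d)"
          using r carr by (simp add: r_distr)
        then show ?thesis
          using C(7) c d by blast
      qed
    qed
    moreover have "x \<otimes> c \<in> ?H" if c: "c \<in> center R" and x: "x \<in> ?H" for c x
    proof -
      from x obtain d where d: "d \<in> center R" "x = r \<otimes> d" by blast
      then have "x \<otimes> c = r \<otimes> (d \<otimes> c)"
        using r c carr by (simp add: m_assoc)
      then show ?thesis
        using C(6) c d by blast
    qed
    ultimately have sub: "submodule ?H (center_ring R) (center_module R)"
      by (simp add: submodule_center_module_iff)
    have "r \<in> ?H"
      using r C(3) by (intro image_eqI[of _ _ \<one>]) auto
    with r ess[OF sub] have "?H \<inter> center R \<noteq> {\<zero>}"
      by blast
    with zero C(2) obtain y where "y \<in> ?H" "y \<in> center R" "y \<noteq> \<zero>"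
      by blast
    then show "\<exists>c \<in> center R. r \<otimes> c \<in> center R - {\<zero>}"
      by blast
  qed
next
  assume elementwise: ?elementwise
  have "submodule (center R) (center_ring R) (center_module R)"
    using subring.axioms(1)[OF subcring.axioms(1)[OF center_subcring]]
      subcringE(6)[OF center_subcring]
    by (simp add: submodule_center_module_iff)
  moreover have "H \<inter> center R \<noteq> {\<zero>}"
    if H: "submodule H (center_ring R) (center_module R)" "H \<noteq> {\<zero>}" for H
  proof -
    from H(1) have sg: "subgroup H (add_monoid R)"
      and closed: "\<And>c x. c \<in> center R \<Longrightarrow> x \<in> H \<Longrightarrow> x \<otimes> c \<in> H"
      by (auto simp: submodule_center_module_iff)
    have "\<zero> \<in> H"
      using subgroup.one_closed[OF sg] by simp
    with H(2) obtain r where "r \<in> H" "r \<noteq> \<zero>" by blast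
    moreover have "H \<subseteq> carrier R"
      using subgroup.subset[OF sg] by simp
    ultimately obtain c where "c \<in> center R" "r \<otimes> c \<in> center R - {\<zero>}"
      using elementwise by blast
    with closed \<open>r \<in> H\<close> show ?thesis by blast
  qed
  ultimately show "centrally_essential_ring R"
    by (auto simp: centrally_essential_ring_def centrally_essential_ring_axioms_def
      essential_submodule_def center_module_def ring_axioms)
qed

end

theory Submission
  imports Defs
begin

text \<open>Everything rests on one identity: if \<open>c\<close> and \<open>a c\<close> are central, then
  \<open>[a, b] c = [a c, b] = 0\<close>. In a centrally essential ring every nonzero element has a nonzero
  central multiple, so such elements \<open>c\<close> abound, and nonzero commutators are annihilated by many
  central elements.

  If the center has no nonzero element of square zero, this already makes every commutator vanish
  (\<open>cring_if_center_reduced\<close>). A central element of square zero generates a nilpotent ideal,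
  both in the center and in the whole ring, so either of the two semiprimeness hypotheses rules
  such elements out. For an idempotent \<open>e\<close>, a nonzero central multiple of an element
  of \<open>e R (1 - e)\<close> would be fixed and killed by \<open>e\<close>; hence idempotents are central. A simple
  \<open>C\<close>-submodule of \<open>R\<close> meets \<open>C\<close>, so it lies in \<open>C\<close>, and the socle with it.

  Now let \<open>R\<close> be semiperfect with radical \<open>J\<close>. In the Artinian ring \<open>R/J\<close>, whose radical is
  zero, every nonzero right ideal contains an idempotent generating a minimal right ideal. If
  some commutator \<open>k\<close> were not in \<open>J\<close>, then \<open>k y\<close> would be congruent modulo \<open>J\<close> to a nonzero
  idempotent for some \<open>y\<close>, and lifting it would give a nonzero central idempotent \<open>e\<close>
  with \<open>k e z = e\<close> for some \<open>z\<close>. The identity above forbids this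
  (\<open>commutator_not_invertible_on_corner\<close>): a nonzero multiple \<open>a e c\<close> in the center gives
  \<open>k e c = 0\<close>, hence \<open>e c = 0\<close>. So \<open>R/J\<close> is commutative, and its identity is a sum
  of orthogonal idempotents whose corners are fields. Lifting this system to \<open>R\<close> splits \<open>R\<close>
  into corners, which inherit central essentiality and are local because the radical of a corner
  is the part of \<open>J\<close> inside it.\<close>


section \<open>Commutators and square-zero central elements\<close>

lemma (in centrally_essential_ring) central_multiple:
  assumes "r \<in> carrier R" "r \<noteq> \<zero>"
  obtains c where "c \<in> center R" "r \<otimes> c \<in> center R" "r \<otimes> c \<noteq> \<zero>"
  using assms centrally_essential_ring_iff centrally_essential_ring_axioms by blast

lemma (in ring) center_carrier: "c \<in> center R \<Longrightarrow> c \<in> carrier R"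
  using center_in_carrier by blast

lemma (in ring) center_commutes: "c \<in> center R \<Longrightarrow> r \<in> carrier R \<Longrightarrow> c \<otimes> r = r \<otimes> c"
  unfolding center_def by blast

text \<open>Both sides of \<open>[a, b] c = [a c, b]\<close> agree because \<open>c\<close> is central, and the right one
  vanishes because \<open>a c\<close> is.\<close>
lemma (in ring) commutator_times_central:
  assumes [simp]: "a \<in> carrier R" "b \<in> carrier R"
    and c: "c \<in> center R" and ac: "a \<otimes> c \<in> center R"
  shows "(a \<otimes> b \<ominus> b \<otimes> a) \<otimes> c = \<zero>"
proof -
  have [simp]: "c \<in> carrier R"
    using c by (rule center_carrier)
  have "a \<otimes> b \<otimes> c = a \<otimes> c \<otimes> b"
    using center_commutes[OF c, of b] by (simp add: m_assoc)
  also have "\<dots> = b \<otimes> a \<otimes> c"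
    using center_commutes[OF ac, of b] by (simp add: m_assoc)
  finally show ?thesis
    by (simp add: minus_eq l_distr l_minus r_neg)
qed

text \<open>A nonzero central multiple \<open>z\<close> of a commutator \<open>[a, b]\<close> is annihilated by the ideal of
  all central \<open>c\<close> with \<open>a c\<close> central. In a reduced center this ideal has zero annihilator, since
  it meets every principal ideal \<open>z C\<close> with \<open>z \<noteq> 0\<close>: it contains \<open>z\<close> itself or a
  nonzero multiple \<open>z e\<close>.\<close>
lemma (in centrally_essential_ring) cring_if_center_reduced:
  assumes reduced: "\<And>c. c \<in> center R \<Longrightarrow> c \<otimes> c = \<zero> \<Longrightarrow> c = \<zero>"
  shows "cring R"
proof -
  have "a \<otimes> b = b \<otimes> a" if [simp]: "a \<in> carrier R" "b \<in> carrier R" for a b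
  proof (rule ccontr)
    assume ne: "a \<otimes> b \<noteq> b \<otimes> a"
    let ?k = "a \<otimes> b \<ominus> b \<otimes> a"
    have "?k \<noteq> \<zero>"
      using ne by simp
    then obtain d where d: "d \<in> center R" "?k \<otimes> d \<in> center R" "?k \<otimes> d \<noteq> \<zero>"
      using central_multiple[of ?k] by auto
    define z where "z = ?k \<otimes> d"
    have z: "z \<in> center R" "z \<noteq> \<zero>"
      using d by (simp_all add: z_def)
    have [simp]: "d \<in> carrier R" "z \<in> carrier R"
      using d z center_carrier by auto
    \<comment> \<open>The annihilation passes from the commutator to its multiple because \<open>c\<close> is central.\<close>
    have ann: "z \<otimes> c = \<zero>" if c: "c \<in> center R" "a \<otimes> c \<in> center R" for c
    proof -
      have [simp]: "c \<in> carrier R"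
        using c center_carrier by auto
      have "z \<otimes> c = ?k \<otimes> c \<otimes> d"
        using center_commutes[OF d(1), of c] by (simp add: z_def m_assoc)
      then show ?thesis
        using commutator_times_central[OF _ _ c] by simp
    qed
    have "\<zero> \<in> center R"
      using subcringE(2)[OF center_subcring] .
    show False
    proof (cases "a \<otimes> z = \<zero>")
      case True
      then have "z \<otimes> z = \<zero>"
        using ann[OF z(1)] \<open>\<zero> \<in> center R\<close> by simp
      then show False
        using reduced z by blast
    next
      case False
      then obtain e where e: "e \<in> center R" "a \<otimes> z \<otimes> e \<in> center R" "a \<otimes> z \<otimes> e \<noteq> \<zero>"
        using central_multiple[of "a \<otimes> z"] by auto
      have [simp]: "e \<in> carrier R"
        using e center_carrier by auto
      have ze: "z \<otimes> e \<in> center R"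
        using subcringE(6)[OF center_subcring] z e by blast
      have "z \<otimes> (z \<otimes> e) = \<zero>"
        using ann[OF ze] e(2) by (simp add: m_assoc)
      then have "z \<otimes> e \<otimes> (z \<otimes> e) = \<zero>"
        using center_commutes[OF e(1), of z] by (metis \<open>e \<in> carrier R\<close> \<open>z \<in> carrier R\<close> m_assoc m_closed r_null)
      then have "z \<otimes> e = \<zero>"
        using reduced ze by blast
      then show False
        using e(3) by (simp add: m_assoc)
    qed
  qed
  then show ?thesis
    by (intro cring.intro comm_monoid.intro comm_monoid_axioms.intro ring_axioms monoid_axioms) auto
qed

text \<open>The multiples of \<open>c\<close> form a two-sided ideal because \<open>c\<close> is central, and the product of
  any two of them contains the factor \<open>c c\<close>.\<close>
lemma (in semiprime_ring) central_square_zero: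
  assumes c: "c \<in> center R" and sq: "c \<otimes> c = \<zero>"
  shows "c = \<zero>"
proof -
  have [simp]: "c \<in> carrier R"
    using c by (rule center_carrier)
  let ?I = "(\<lambda>r. c \<otimes> r) ` carrier R"
  have I: "ideal ?I R"
  proof (rule idealI[OF ring_axioms])
    show "subgroup ?I (add_monoid R)"
    proof (rule add.subgroupI)
      show "\<ominus> a \<in> ?I" if "a \<in> ?I" for a
        using that by (auto simp: r_minus[symmetric])
      show "a \<oplus> b \<in> ?I" if "a \<in> ?I" "b \<in> ?I" for a b
        using that by (auto simp: r_distr[symmetric])
    qed auto
    fix a x assume "a \<in> ?I" and x: "x \<in> carrier R"
    then obtain r where r: "r \<in> carrier R" "a = c \<otimes> r"
      by blast
    have "x \<otimes> a = c \<otimes> (x \<otimes> r)"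
      using r x center_commutes[OF c x] by (simp add: m_assoc[symmetric])
    then show "x \<otimes> a \<in> ?I"
      using r x by blast
    show "a \<otimes> x \<in> ?I"
      using r x by (auto simp: m_assoc)
  qed
  \<comment> \<open>The second power in the monoid of ideals starts from its unit, the whole ring.\<close>
  have "ideal_prod R (ideal_prod R (carrier R) ?I) ?I = {\<zero>}"
  proof
    have sub: "ideal_prod R (carrier R) ?I \<subseteq> ?I"
      using ideal_prod_inter[OF oneideal I] by blast
    have "s = \<zero>" if "s \<in> ideal_prod R (ideal_prod R (carrier R) ?I) ?I" for s
      using that
    proof induction
      case (prod i j)
      then obtain r t where r: "r \<in> carrier R" "i = c \<otimes> r" and t: "t \<in> carrier R" "j = c \<otimes> t"
        using sub by blast
      have "i \<otimes> j = c \<otimes> (r \<otimes> c) \<otimes> t"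
        using r t by (simp add: m_assoc)
      also have "\<dots> = c \<otimes> (c \<otimes> r) \<otimes> t"
        using center_commutes[OF c r(1)] by simp
      also have "\<dots> = c \<otimes> c \<otimes> (r \<otimes> t)"
        using r t by (simp add: m_assoc)
      finally show ?case
        using r t sq by simp
    qed simp
    then show "ideal_prod R (ideal_prod R (carrier R) ?I) ?I \<subseteq> {\<zero>}"
      by blast
    show "{\<zero>} \<subseteq> ideal_prod R (ideal_prod R (carrier R) ?I) ?I"
      using additive_subgroup.zero_closed[OF ideal.axioms(1)[OF
          ideal_prod_is_ideal[OF ideal_prod_is_ideal[OF oneideal I] I]]] by blast
  qed
  then have "?I [^]\<^bsub>ideals_set R\<^esub> (2::nat) = {\<zero>}"
    by (simp add: nat_pow_def ideals_set_def numeral_2_eq_2)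
  then have "?I = {\<zero>}"
    using nilpotent_ideal_zero I unfolding nilpotent_ideal_def by blast
  moreover have "c \<otimes> \<one> \<in> ?I"
    by blast
  ultimately show ?thesis
    by simp
qed

lemma (in ring) center_center_ring: "center (center_ring R) = center R"
  using center_in_carrier by (auto simp: center_def)


section \<open>Central idempotents and the socle\<close>

text \<open>The elements \<open>e x (1 - e)\<close> and \<open>(1 - e) x e\<close> measure the failure of \<open>e\<close> to commute
  with \<open>x\<close>. Each is fixed by one of the idempotents \<open>e\<close>, \<open>1 - e\<close> on the left and killed by the
  same one on the right, which a nonzero central multiple could not be.\<close>
lemma (in centrally_essential_ring) idempotent_central:
  assumes "idempotent_elem R e"
  shows "e \<in> center R"
proof -
  have [simp]: "e \<in> carrier R" and ee: "e \<otimes> e = e"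
    using assms by (auto simp: idempotent_elem_def)
  \<comment> \<open>A central multiple \<open>d = r c\<close> satisfies \<open>d = f d = d f = 0\<close>; this is used for \<open>f = e\<close> and \<open>f = 1 - e\<close>.\<close>
  have vanish: "r = \<zero>"
    if [simp]: "r \<in> carrier R" "f \<in> carrier R" and fr: "f \<otimes> r = r" "r \<otimes> f = \<zero>" for r f
  proof (rule ccontr)
    assume "r \<noteq> \<zero>"
    then obtain c where c: "c \<in> center R" "r \<otimes> c \<in> center R" "r \<otimes> c \<noteq> \<zero>"
      using central_multiple[of r] by auto
    have [simp]: "c \<in> carrier R"
      using c center_carrier by auto
    have "r \<otimes> c = f \<otimes> (r \<otimes> c)"
      using fr by (simp add: m_assoc[symmetric])
    also have "\<dots> = r \<otimes> c \<otimes> f"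
      using center_commutes[OF c(2), of f] by simp
    also have "\<dots> = r \<otimes> f \<otimes> c"
      using center_commutes[OF c(1), of f] by (simp add: m_assoc)
    finally show False
      using fr c by simp
  qed
  have "e \<otimes> x = x \<otimes> e" if [simp]: "x \<in> carrier R" for x
  proof -
    have e1: "e \<otimes> (e \<otimes> z) = e \<otimes> z" if "z \<in> carrier R" for z
      using that ee by (simp add: m_assoc[symmetric])
    have "e \<otimes> x \<ominus> e \<otimes> x \<otimes> e = \<zero>"
      by (rule vanish[of _ e])
        (simp_all add: minus_eq r_distr l_distr r_minus l_minus m_assoc ee e1 r_neg)
    moreover have "x \<otimes> e \<ominus> e \<otimes> x \<otimes> e = \<zero>"
      by (rule vanish[of _ "\<one> \<ominus> e"])
        (simp_all add: minus_eq r_distr l_distr r_minus l_minus m_assoc ee e1 r_neg r_neg1 r_neg2 minus_add a_ac)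
    ultimately show ?thesis
      by simp
  qed
  then show ?thesis
    by (simp add: center_def)
qed

text \<open>A simple submodule meets the center in a nonzero submodule of itself, hence is contained in
  the center.\<close>
lemma (in centrally_essential_ring) socle_subset_center:
  "socle (center_ring R) (center_module R) \<subseteq> center R"
proof -
  have C: "submodule (center R) (center_ring R) (center_module R)"
    and ess: "\<And>H. submodule H (center_ring R) (center_module R) \<Longrightarrow> H \<noteq> {\<zero>} \<Longrightarrow> H \<inter> center R \<noteq> {\<zero>}"
    using center_essential by (auto simp: essential_submodule_def center_module_def)
  have sub: "N \<subseteq> center R" if N: "simple_submodule N (center_ring R) (center_module R)" for N
  proof -
    have N': "submodule N (center_ring R) (center_module R)" "N \<noteq> {\<zero>}"
      "\<And>H. submodule H (center_ring R) (center_module R) \<Longrightarrow> H \<subseteq> N \<Longrightarrow> H = {\<zero>} \<or> H = N"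
      using N by (auto simp: simple_submodule_def center_module_def)
    have "submodule (N \<inter> center R) (center_ring R) (center_module R)"
      using C N'(1) add.subgroups_Inter_pair unfolding submodule_center_module_iff by auto
    then have "N \<inter> center R = N"
      using N'(3)[of "N \<inter> center R"] ess[OF N'(1,2)] by blast
    then show ?thesis
      by blast
  qed
  interpret center_module: module "center_ring R" "center_module R"
    by (rule center_module_module)
  have "subgroup (center R) (add_monoid (center_module R))"
    using C by (simp add: submodule_def)
  then show ?thesis
    unfolding socle_def using sub by (intro center_module.add.generate_subgroup_incl) auto
qed

section \<open>Maximal right ideals and the Jacobson radical\<close>

text \<open>Closure under negatives comes for free, as multiplication by \<open>-1\<close>.\<close>
lemma (in ring) right_idealI:
  assumes "I \<subseteq> carrier R" "\<zero> \<in> I"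
    and add: "\<And>a b. a \<in> I \<Longrightarrow> b \<in> I \<Longrightarrow> a \<oplus> b \<in> I"
    and mult: "\<And>a x. a \<in> I \<Longrightarrow> x \<in> carrier R \<Longrightarrow> a \<otimes> x \<in> I"
  shows "right_ideal I R"
proof (intro right_ideal.intro right_ideal_axioms.intro additive_subgroup.intro ring_axioms mult)
  show "subgroup I (add_monoid R)"
  proof (rule add.subgroupI)
    show "\<ominus> a \<in> I" if "a \<in> I" for a
    proof -
      have "\<ominus> a = a \<otimes> \<ominus> \<one>"
        using that assms(1) by (auto simp: r_minus)
      then show ?thesis
        using mult[OF that, of "\<ominus> \<one>"] by simp
    qed
  qed (use assms in auto)
qed

lemma right_idealD:
  assumes "right_ideal I R"
  shows "I \<subseteq> carrier R" "\<zero>\<^bsub>R\<^esub> \<in> I"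
    and "a \<in> I \<Longrightarrow> b \<in> I \<Longrightarrow> a \<oplus>\<^bsub>R\<^esub> b \<in> I"
    and "a \<in> I \<Longrightarrow> b \<in> I \<Longrightarrow> a \<ominus>\<^bsub>R\<^esub> b \<in> I"
    and "a \<in> I \<Longrightarrow> x \<in> carrier R \<Longrightarrow> a \<otimes>\<^bsub>R\<^esub> x \<in> I"
proof -
  interpret right_ideal I R
    by fact
  show "I \<subseteq> carrier R" "\<zero>\<^bsub>R\<^esub> \<in> I"
    "a \<in> I \<Longrightarrow> b \<in> I \<Longrightarrow> a \<oplus>\<^bsub>R\<^esub> b \<in> I"
    "a \<in> I \<Longrightarrow> x \<in> carrier R \<Longrightarrow> a \<otimes>\<^bsub>R\<^esub> x \<in> I"
    using a_subset I_r_closed by auto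
  show "a \<in> I \<Longrightarrow> b \<in> I \<Longrightarrow> a \<ominus>\<^bsub>R\<^esub> b \<in> I"
    by (simp add: minus_eq a_inv_closed)
qed

lemma (in ring) principal_right_ideal:
  assumes [simp]: "a \<in> carrier R"
  shows "right_ideal ((\<lambda>x. a \<otimes> x) ` carrier R) R"
proof (rule right_idealI)
  show "\<zero> \<in> (\<lambda>x. a \<otimes> x) ` carrier R"
    by (rule image_eqI[of _ _ \<zero>]) auto
qed (auto simp: r_distr[symmetric] m_assoc)

lemma (in ring) right_ideal_with_one:
  assumes "right_ideal I R" "\<one> \<in> I"
  shows "I = carrier R"
  using right_idealD(1,5)[OF assms(1)] assms(2) by (metis l_one subsetI subset_antisym)

lemma (in ring) one_notin_maximal:
  assumes "maximal_right_ideal K R"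
  shows "\<one> \<notin> K"
  using maximal_right_ideal.I_notcarr[OF assms] right_ideal_with_one
    maximal_right_ideal.axioms(1)[OF assms] by blast

text \<open>Zorn's lemma applies because the union of a chain of right ideals avoiding \<open>1\<close> is again
  one.\<close>
lemma (in ring) proper_right_ideal_in_maximal:
  assumes I: "right_ideal I R" and "\<one> \<notin> I"
  obtains M where "maximal_right_ideal M R" "I \<subseteq> M"
proof -
  let ?S = "{K. right_ideal K R \<and> I \<subseteq> K \<and> \<one> \<notin> K}"
  have "\<exists>M \<in> ?S. \<forall>K \<in> ?S. M \<subseteq> K \<longrightarrow> K = M"
  proof (rule subset_Zorn_nonempty)
    show "?S \<noteq> {}"
      using assms by blast
    fix \<C> assume ne: "\<C> \<noteq> {}" and ch: "subset.chain ?S \<C>"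
    have mem: "right_ideal K R" "I \<subseteq> K" "\<one> \<notin> K" if "K \<in> \<C>" for K
      using that ch by (auto simp: subset.chain_def)
    have "right_ideal (\<Union>\<C>) R"
    proof (rule right_idealI)
      show "a \<oplus> b \<in> \<Union>\<C>" if "a \<in> \<Union>\<C>" "b \<in> \<Union>\<C>" for a b
      proof -
        from that obtain K L where KL: "K \<in> \<C>" "a \<in> K" "L \<in> \<C>" "b \<in> L"
          by blast
        with ch have "K \<subseteq> L \<or> L \<subseteq> K"
          by (auto simp: subset.chain_def)
        then show ?thesis
          using KL right_idealD(3)[OF mem(1)[OF KL(1)], of a b] right_idealD(3)[OF mem(1)[OF KL(3)], of a b]
          by blast
      qed
    next
      show "\<Union>\<C> \<subseteq> carrier R"
        using right_idealD(1)[OF mem(1)] by blast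
      obtain K where "K \<in> \<C>"
        using ne by blast
      then show "\<zero> \<in> \<Union>\<C>"
        using right_idealD(2)[OF mem(1)] by blast
      show "a \<otimes> x \<in> \<Union>\<C>" if "a \<in> \<Union>\<C>" "x \<in> carrier R" for a x
      proof -
        from that obtain K where "K \<in> \<C>" "a \<in> K"
          by blast
        then have "a \<otimes> x \<in> K"
          using right_idealD(5)[OF mem(1)] that(2) by blast
        then show ?thesis
          using \<open>K \<in> \<C>\<close> by blast
      qed
    qed
    moreover have "I \<subseteq> \<Union>\<C>"
      using mem(2) ne by blast
    moreover have "\<one> \<notin> \<Union>\<C>"
      using mem(3) by blast
    ultimately show "\<Union>\<C> \<in> ?S"
      by simp
  qed
  then obtain M where M: "right_ideal M R" "I \<subseteq> M" "\<one> \<notin> M"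
    and max: "\<And>K. right_ideal K R \<Longrightarrow> I \<subseteq> K \<Longrightarrow> \<one> \<notin> K \<Longrightarrow> M \<subseteq> K \<Longrightarrow> K = M"
    by auto
  have "maximal_right_ideal M R"
  proof (intro maximal_right_ideal.intro maximal_right_ideal_axioms.intro M(1))
    show "carrier R \<noteq> M"
      using M(3) by auto
    show "K = M \<or> K = carrier R" if "right_ideal K R" "M \<subseteq> K" "K \<subseteq> carrier R" for K
    proof (cases "\<one> \<in> K")
      case True
      then show ?thesis
        using right_ideal_with_one that(1) by simp
    next
      case False
      have "I \<subseteq> K"
        using M(2) that(2) by simp
      then show ?thesis
        using max that False by simp
    qed
  qed
  with M(2) that show thesis
    by blast
qed

lemma (in ring) maximal_right_ideal_complement:
  assumes K: "maximal_right_ideal K R" and M: "right_ideal M R" and "\<not> M \<subseteq> K"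
  obtains k m where "k \<in> K" "m \<in> M" "\<one> = k \<oplus> m"
proof -
  note K' = right_idealD[OF maximal_right_ideal.axioms(1)[OF K]]
  note M' = right_idealD[OF M]
  let ?L = "{k \<oplus> m |k m. k \<in> K \<and> m \<in> M}"
  have carr: "k \<in> K \<Longrightarrow> k \<in> carrier R" "m \<in> M \<Longrightarrow> m \<in> carrier R" for k m
    using K'(1) M'(1) by auto
  have L: "right_ideal ?L R"
  proof (rule right_idealI)
    show "\<zero> \<in> ?L"
      using K'(2) M'(2) by force
    show "a \<oplus> b \<in> ?L" if "a \<in> ?L" "b \<in> ?L" for a b
    proof -
      from that obtain k m k' m' where *: "k \<in> K" "m \<in> M" "a = k \<oplus> m" "k' \<in> K" "m' \<in> M" "b = k' \<oplus> m'"
        by blast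
      then have "a \<oplus> b = (k \<oplus> k') \<oplus> (m \<oplus> m')"
        using carr by (simp add: a_ac)
      then show ?thesis
        using * K'(3) M'(3) by blast
    qed
    show "a \<otimes> x \<in> ?L" if "a \<in> ?L" "x \<in> carrier R" for a x
    proof -
      from that obtain k m where *: "k \<in> K" "m \<in> M" "a = k \<oplus> m"
        by blast
      then have "a \<otimes> x = (k \<otimes> x) \<oplus> (m \<otimes> x)"
        using carr that by (simp add: l_distr)
      then show ?thesis
        using * that K'(5) M'(5) by blast
    qed
  qed (use carr in auto)
  have K_le: "K \<subseteq> ?L" and M_le: "M \<subseteq> ?L"
  proof -
    show "K \<subseteq> ?L"
    proof
      fix k assume "k \<in> K"
      then have "k = k \<oplus> \<zero>"
        using carr by simp
      then show "k \<in> ?L"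
        using \<open>k \<in> K\<close> M'(2) by blast
    qed
    show "M \<subseteq> ?L"
    proof
      fix m assume "m \<in> M"
      then have "m = \<zero> \<oplus> m"
        using carr by simp
      then show "m \<in> ?L"
        using \<open>m \<in> M\<close> K'(2) by blast
    qed
  qed
  have "?L \<subseteq> carrier R"
    using right_idealD(1)[OF L] .
  then have "?L = K \<or> ?L = carrier R"
    using maximal_right_ideal.I_maximal[OF K L K_le] by blast
  then have "?L = carrier R"
    using M_le \<open>\<not> M \<subseteq> K\<close> by blast
  then have "\<one> \<in> ?L"
    by simp
  then show thesis
    using that by blast
qed

text \<open>The elementwise description of the radical makes it possible to move it between \<open>R\<close>, its
  quotients and its corners without a correspondence between maximal right ideals. If \<open>1 - x y\<close>
  had no right inverse, the right ideal it generates would lie in a maximal one, which contains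
  \<open>x y\<close> and therefore \<open>1\<close>. Conversely, if \<open>x\<close> lies outside a maximal right ideal \<open>K\<close>, then
  \<open>1 = k + x y\<close> with \<open>k \<in> K\<close>, and \<open>k = 1 - x y\<close> has no right inverse.\<close>
lemma (in ring) jacobson_radical_iff:
  "x \<in> jacobson_radical R \<longleftrightarrow>
     x \<in> carrier R \<and> (\<forall>y \<in> carrier R. \<exists>u \<in> carrier R. (\<one> \<ominus> x \<otimes> y) \<otimes> u = \<one>)"
    (is "_ \<longleftrightarrow> _ \<and> ?quasi")
proof (intro iffI conjI)
  assume x: "x \<in> jacobson_radical R"
  then show [simp]: "x \<in> carrier R"
    by (simp add: jacobson_radical_def)
  show ?quasi
  proof (rule ballI, rule ccontr)
    fix y assume [simp]: "y \<in> carrier R"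
    assume no_inverse: "\<not> (\<exists>u \<in> carrier R. (\<one> \<ominus> x \<otimes> y) \<otimes> u = \<one>)"
    let ?I = "(\<lambda>u. (\<one> \<ominus> x \<otimes> y) \<otimes> u) ` carrier R"
    have "right_ideal ?I R"
      by (rule principal_right_ideal) simp
    moreover have "\<one> \<notin> ?I"
      using no_inverse by auto
    ultimately obtain K where K: "maximal_right_ideal K R" "?I \<subseteq> K"
      by (rule proper_right_ideal_in_maximal)
    note K' = right_idealD[OF maximal_right_ideal.axioms(1)[OF K(1)]]
    have "(\<one> \<ominus> x \<otimes> y) \<otimes> \<one> \<in> K"
      using K(2) by blast
    moreover have "x \<otimes> y \<in> K"
      using x K(1) K'(5) by (auto simp: jacobson_radical_def)
    ultimately have "(\<one> \<ominus> x \<otimes> y) \<oplus> x \<otimes> y \<in> K"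
      using K'(3) by simp
    moreover have "(\<one> \<ominus> x \<otimes> y) \<oplus> x \<otimes> y = \<one>"
      by (simp add: minus_eq a_assoc l_neg)
    ultimately show False
      using one_notin_maximal[OF K(1)] by simp
  qed
next
  assume "x \<in> carrier R \<and> ?quasi"
  then have [simp]: "x \<in> carrier R" and quasi: ?quasi
    by auto
  have "x \<in> K" if K: "maximal_right_ideal K R" for K
  proof (rule ccontr)
    assume "x \<notin> K"
    note K' = right_idealD[OF maximal_right_ideal.axioms(1)[OF K]]
    have "x \<otimes> \<one> \<in> (\<lambda>y. x \<otimes> y) ` carrier R"
      by blast
    then have "\<not> (\<lambda>y. x \<otimes> y) ` carrier R \<subseteq> K"
      using \<open>x \<notin> K\<close> by auto
    then obtain k y where k: "k \<in> K" and [simp]: "y \<in> carrier R" and one: "\<one> = k \<oplus> x \<otimes> y"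
    proof -
      obtain k m where "k \<in> K" "m \<in> (\<lambda>y. x \<otimes> y) ` carrier R" "\<one> = k \<oplus> m"
        by (rule maximal_right_ideal_complement[OF K principal_right_ideal[of x]])
          (use \<open>\<not> (\<lambda>y. x \<otimes> y) ` carrier R \<subseteq> K\<close> in auto)
      then show thesis
        using that by blast
    qed
    have [simp]: "k \<in> carrier R"
      using k K'(1) by auto
    obtain u where u: "u \<in> carrier R" "(\<one> \<ominus> x \<otimes> y) \<otimes> u = \<one>"
      using quasi \<open>y \<in> carrier R\<close> by blast
    have "\<one> \<ominus> x \<otimes> y = k"
      by (subst one) (simp add: minus_eq a_assoc r_neg)
    then have "\<one> \<in> K"
      using u k K'(5) by metis
    then show False
      using one_notin_maximal[OF K] by simp
  qed
  then show "x \<in> jacobson_radical R"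
    by (simp add: jacobson_radical_def)
qed

text \<open>Only closure under left multiplication is not built into the definition. It is Jacobson's
  trick: with \<open>a = x z\<close>, a right inverse \<open>u\<close> of \<open>1 - a y\<close> yields the right inverse
  \<open>1 + y u a\<close> of \<open>1 - y a\<close>.\<close>
lemma (in ring) jacobson_radical_ideal: "ideal (jacobson_radical R) R"
proof (rule idealI[OF ring_axioms])
  have J: "right_ideal (jacobson_radical R) R"
  proof (rule right_idealI)
    show "jacobson_radical R \<subseteq> carrier R" "\<zero> \<in> jacobson_radical R"
      using right_idealD(2)[OF maximal_right_ideal.axioms(1)] by (auto simp: jacobson_radical_def)
    show "a \<oplus> b \<in> jacobson_radical R" if "a \<in> jacobson_radical R" "b \<in> jacobson_radical R" for a b
      using that right_idealD(3)[OF maximal_right_ideal.axioms(1), of _ R] by (simp add: jacobson_radical_def)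
    show "a \<otimes> x \<in> jacobson_radical R" if "a \<in> jacobson_radical R" "x \<in> carrier R" for a x
      using that right_idealD(5)[OF maximal_right_ideal.axioms(1), of _ R] by (simp add: jacobson_radical_def)
  qed
  then show "subgroup (jacobson_radical R) (add_monoid R)"
    by (simp add: right_ideal_def additive_subgroup_def)
  fix x y assume x: "x \<in> jacobson_radical R" and [simp]: "y \<in> carrier R"
  have [simp]: "x \<in> carrier R"
    using x by (simp add: jacobson_radical_iff)
  show "x \<otimes> y \<in> jacobson_radical R"
    using right_idealD(5)[OF J x] by simp
  have "\<exists>v \<in> carrier R. (\<one> \<ominus> y \<otimes> x \<otimes> z) \<otimes> v = \<one>" if [simp]: "z \<in> carrier R" for z
  proof -
    let ?a = "x \<otimes> z"
    obtain u where [simp]: "u \<in> carrier R" and u: "(\<one> \<ominus> x \<otimes> (z \<otimes> y)) \<otimes> u = \<one>"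
      using x m_closed[OF \<open>z \<in> carrier R\<close> \<open>y \<in> carrier R\<close>] unfolding jacobson_radical_iff by blast
    then have u': "u \<ominus> ?a \<otimes> y \<otimes> u = \<one>"
      by (simp add: minus_eq l_distr l_minus m_assoc)
    define v where "v = y \<otimes> u \<otimes> ?a"
    have [simp]: "v \<in> carrier R"
      by (simp add: v_def)
    have "v \<ominus> y \<otimes> ?a \<otimes> v = y \<otimes> (u \<ominus> ?a \<otimes> y \<otimes> u) \<otimes> ?a"
      by (simp add: v_def minus_eq l_distr r_distr l_minus r_minus m_assoc)
    then have v: "v \<ominus> y \<otimes> ?a \<otimes> v = y \<otimes> ?a"
      by (simp add: u')
    have "(\<one> \<ominus> y \<otimes> ?a) \<otimes> (\<one> \<oplus> v) = (\<one> \<ominus> y \<otimes> ?a) \<oplus> (v \<ominus> y \<otimes> ?a \<otimes> v)"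
      by (simp add: minus_eq l_distr r_distr l_minus)
    also have "\<dots> = \<one>"
      unfolding v by (simp add: minus_eq a_assoc l_neg)
    finally show ?thesis
      by (intro bexI[of _ "\<one> \<oplus> v"]) (simp_all add: m_assoc)
  qed
  then show "y \<otimes> x \<in> jacobson_radical R"
    by (simp add: jacobson_radical_iff)
qed


section \<open>Artinian rings with zero radical\<close>

text \<open>The last clause says that the nonzero right ideal \<open>e R\<close> is minimal: each of its nonzero
  elements generates it.\<close>
definition minimal_idempotent :: "('a, 'b) ring_scheme \<Rightarrow> 'a \<Rightarrow> bool"
  where "minimal_idempotent R e \<longleftrightarrow>
    idempotent_elem R e \<and> e \<noteq> \<zero>\<^bsub>R\<^esub> \<and>
    (\<forall>x \<in> carrier R. e \<otimes>\<^bsub>R\<^esub> x \<noteq> \<zero>\<^bsub>R\<^esub> \<longrightarrow> (\<exists>y \<in> carrier R. e \<otimes>\<^bsub>R\<^esub> x \<otimes>\<^bsub>R\<^esub> y = e))"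

lemma (in artinian_ring) wf_right_ideals:
  "wf {(I, K). right_ideal I R \<and> right_ideal K R \<and> I \<subset> K}"
  unfolding wf_iff_no_infinite_down_chain
proof (rule notI, erule exE)
  fix I assume I: "\<forall>i. (I (Suc i), I i) \<in> {(I, K). right_ideal I R \<and> right_ideal K R \<and> I \<subset> K}"
  have 1: "right_ideal (I i) R" for i
    using spec[OF I, of i] by (simp only: mem_Collect_eq prod.case)
  have 2: "I (Suc i) \<subset> I i" for i
    using spec[OF I, of i] by (simp only: mem_Collect_eq prod.case)
  have "\<exists>n. \<forall>m\<ge>n. I m = I n"
    by (rule right_dcc[where I = I, OF 1 psubset_imp_subset[OF 2]])
  then obtain n where "\<forall>m\<ge>n. I m = I n"
    by (rule exE)
  then have "I (Suc n) = I n"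
    by (rule allE[of _ "Suc n"]) simp
  then show False
    using 2[of n] by simp
qed

lemma (in artinian_ring) minimal_right_ideal_below:
  assumes "right_ideal I R" "I \<noteq> {\<zero>}"
  obtains M where "right_ideal M R" "M \<subseteq> I" "M \<noteq> {\<zero>}"
    "\<And>K. right_ideal K R \<Longrightarrow> K \<subseteq> M \<Longrightarrow> K \<noteq> {\<zero>} \<Longrightarrow> K = M"
proof -
  let ?Q = "{K. right_ideal K R \<and> K \<subseteq> I \<and> K \<noteq> {\<zero>}}"
  have I: "I \<in> ?Q"
    using assms by simp
  obtain M where M: "M \<in> ?Q"
    and min: "\<And>K. (K, M) \<in> {(I, K). right_ideal I R \<and> right_ideal K R \<and> I \<subset> K} \<Longrightarrow> K \<notin> ?Q"
    by (rule wfE_min[OF wf_right_ideals I]) (rule that, assumption, blast)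
  show thesis
  proof (rule that)
    show "K = M" if "right_ideal K R" "K \<subseteq> M" "K \<noteq> {\<zero>}" for K
    proof (rule ccontr)
      assume "K \<noteq> M"
      then have "(K, M) \<in> {(I, K). right_ideal I R \<and> right_ideal K R \<and> I \<subset> K}"
        using that M by auto
      then show False
        using min[of K] that M by auto
    qed
  qed (use M in auto)
qed

text \<open>Take a minimal right ideal \<open>M\<close> inside \<open>I\<close>. Since the radical is zero, some maximal right
  ideal \<open>K\<close> does not contain \<open>M\<close>, so \<open>M \<inter> K = 0\<close> and \<open>1 = k + m\<close> with \<open>k \<in> K\<close>,
  \<open>m \<in> M\<close>. The component \<open>m\<close> of \<open>1\<close> is the idempotent.\<close>
lemma (in artinian_ring) minimal_idempotent_in_right_ideal:
  assumes radical: "jacobson_radical R = {\<zero>}"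
    and I: "right_ideal I R" "I \<noteq> {\<zero>}"
  obtains e where "e \<in> I" "minimal_idempotent R e"
proof -
  obtain M where M: "right_ideal M R" "M \<subseteq> I" "M \<noteq> {\<zero>}"
    and min: "\<And>K. right_ideal K R \<Longrightarrow> K \<subseteq> M \<Longrightarrow> K \<noteq> {\<zero>} \<Longrightarrow> K = M"
    using minimal_right_ideal_below[OF I] by metis
  note M' = right_idealD[OF M(1)]
  have "\<not> M \<subseteq> jacobson_radical R"
    using M(3) M'(2) radical by auto
  then obtain K where K: "maximal_right_ideal K R" "\<not> M \<subseteq> K"
    using M'(1) by (auto simp: jacobson_radical_def)
  note K' = right_idealD[OF maximal_right_ideal.axioms(1)[OF K(1)]]
  obtain k m where km: "k \<in> K" "m \<in> M" "\<one> = k \<oplus> m"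
    using maximal_right_ideal_complement[OF K(1) M(1) K(2)] .
  have [simp]: "k \<in> carrier R" "m \<in> carrier R"
    using km K'(1) M'(1) by auto
  have "right_ideal (M \<inter> K) R"
    using M' K' by (intro right_idealI) auto
  then have inter: "M \<inter> K = {\<zero>}"
    using min[of "M \<inter> K"] K(2) by blast
  have "m = (k \<oplus> m) \<otimes> m"
    by (simp flip: km(3))
  then have split: "m = k \<otimes> m \<oplus> m \<otimes> m"
    by (simp add: l_distr)
  then have "m \<ominus> m \<otimes> m = k \<otimes> m"
    by (metis \<open>k \<in> carrier R\<close> \<open>m \<in> carrier R\<close> add.inv_solve_right' m_closed minus_eq a_comm)
  \<comment> \<open>The left side shows that this element lies in \<open>M\<close>, the right side that it lies in \<open>K\<close>.\<close>
  then have "k \<otimes> m \<in> M \<inter> K"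
    using km K'(5) M'(4,5) by (metis IntI \<open>m \<in> carrier R\<close>)
  then have "k \<otimes> m = \<zero>"
    using inter by simp
  then have idem: "m \<otimes> m = m"
    using split by simp
  have "m \<noteq> \<zero>"
    using km one_notin_maximal[OF K(1)] by auto
  have "\<exists>y \<in> carrier R. m \<otimes> x \<otimes> y = m" if [simp]: "x \<in> carrier R" and "m \<otimes> x \<noteq> \<zero>" for x
  proof -
    let ?X = "(\<lambda>y. m \<otimes> x \<otimes> y) ` carrier R"
    have "?X \<subseteq> M"
      using M'(5) km by auto
    moreover have "m \<otimes> x \<otimes> \<one> \<in> ?X"
      by blast
    ultimately have "?X = M"
      using min[OF principal_right_ideal[of "m \<otimes> x"]] \<open>m \<otimes> x \<noteq> \<zero>\<close> by auto
    then have "m \<in> ?X"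
      using km(2) by simp
    then obtain y where "y \<in> carrier R" "m = m \<otimes> x \<otimes> y"
      by (rule imageE)
    then show ?thesis
      by (intro bexI[of _ y]) simp_all
  qed
  then have "minimal_idempotent R m"
    using idem \<open>m \<noteq> \<zero>\<close> by (simp add: minimal_idempotent_def idempotent_elem_def)
  then show thesis
    using that km M(2) by blast
qed

text \<open>Split a minimal idempotent \<open>e\<close> off an idempotent \<open>f \<noteq> 0\<close>. The remainder \<open>f - e\<close>
  generates a strictly smaller right ideal, so by the descending chain condition the process
  stops; it is started at \<open>f = 1\<close>.\<close>
lemma (in artinian_ring) minimal_idempotent_decomposition:
  assumes radical: "jacobson_radical R = {\<zero>}" and comm: "cring R"
  obtains n e where "complete_orthogonal_idempotents R n e" "\<And>i. i < n \<Longrightarrow> minimal_idempotent R (e i)"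
proof -
  interpret cring R
    by fact
  \<comment> \<open>The condition \<open>e i f = e i\<close> makes the idempotents found for \<open>f - e\<close> orthogonal to \<open>e\<close>.\<close>
  define decomposes where "decomposes f n e \<longleftrightarrow>
    (\<forall>i<n. minimal_idempotent R (e i) \<and> e i \<otimes> f = e i) \<and>
    (\<forall>i<n. \<forall>j<n. i \<noteq> j \<longrightarrow> e i \<otimes> e j = \<zero>) \<and> finsum R e {..<n} = f"
    for f n and e :: "nat \<Rightarrow> 'a"
  have ex: "\<exists>n e. decomposes f n e" if "idempotent_elem R f" "(\<lambda>x. f \<otimes> x) ` carrier R = I" for f I
    using wf_right_ideals that
  proof (induction I arbitrary: f rule: wf_induct_rule)
    case (less I f)
    have [simp]: "f \<in> carrier R" and ff: "f \<otimes> f = f"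
      using less.prems(1) by (auto simp: idempotent_elem_def)
    have fI: "right_ideal I R"
      using principal_right_ideal[of f] less.prems(2) by simp
    have fin: "f \<in> I"
      using less.prems(2) by (force intro: image_eqI[of _ _ \<one>])
    show ?case
    proof (cases "f = \<zero>")
      case True
      then have "decomposes f 0 (\<lambda>_. \<zero>)"
        by (simp add: decomposes_def)
      then show ?thesis
        by blast
    next
      case False
      then obtain e where e: "e \<in> I" "minimal_idempotent R e"
        using minimal_idempotent_in_right_ideal[OF radical fI] fin by blast
      have [simp]: "e \<in> carrier R" and ee: "e \<otimes> e = e" and "e \<noteq> \<zero>"
        using e(2) by (auto simp: idempotent_elem_def minimal_idempotent_def)
      have fe: "f \<otimes> e = e"
      proof -
        obtain x where "x \<in> carrier R" "e = f \<otimes> x"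
          using e(1) less.prems(2) by blast
        then show ?thesis
          by (simp add: m_assoc[symmetric] ff)
      qed
      then have ef: "e \<otimes> f = e"
        by (simp add: m_comm)
      let ?g = "f \<ominus> e"
      have eg: "e \<otimes> ?g = \<zero>"
        by (simp add: minus_eq r_distr r_minus ef ee r_neg)
      have fg: "f \<otimes> ?g = ?g"
        by (simp add: minus_eq r_distr r_minus ff fe)
      have "?g \<otimes> ?g = f \<otimes> ?g \<ominus> e \<otimes> ?g"
        by (simp add: minus_eq l_distr l_minus)
      also have "\<dots> = ?g"
        unfolding fg eg by (simp add: minus_eq)
      finally have g: "idempotent_elem R ?g"
        by (simp add: idempotent_elem_def)
      let ?G = "(\<lambda>x. ?g \<otimes> x) ` carrier R"
      have "?G \<subseteq> I"
      proof
        fix z assume "z \<in> ?G"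
        then obtain x where "x \<in> carrier R" "z = ?g \<otimes> x"
          by blast
        then have "z = f \<otimes> (?g \<otimes> x)"
          using fg by (simp add: m_assoc[symmetric])
        then show "z \<in> I"
          using \<open>x \<in> carrier R\<close> less.prems(2) by auto
      qed
      moreover have "e \<notin> ?G"
      proof
        assume "e \<in> ?G"
        then obtain x where x: "x \<in> carrier R" "e = ?g \<otimes> x"
          by blast
        then have "e \<otimes> e = e \<otimes> ?g \<otimes> x"
          by (simp add: m_assoc)
        then show False
          using eg ee x \<open>e \<noteq> \<zero>\<close> by simp
      qed
      ultimately have "?G \<subset> I"
        using e(1) by blast
      then obtain n e' where d: "decomposes ?g n e'"
        using less.IH[of ?G ?g] g fI principal_right_ideal[of ?g] by auto
      have e'g: "e' i \<otimes> ?g = e' i" and [simp]: "e' i \<in> carrier R" if "i < n" for i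
        using d that by (auto simp: decomposes_def minimal_idempotent_def idempotent_elem_def)
      have e'e: "e' i \<otimes> e = \<zero>" if "i < n" for i
      proof -
        have "e' i \<otimes> e = e' i \<otimes> ?g \<otimes> e"
          using e'g[OF that] by simp
        also have "\<dots> = e' i \<otimes> (e \<otimes> ?g)"
          using that m_comm[of ?g e] by (simp add: m_assoc)
        finally show ?thesis
          using eg that by simp
      qed
      have e'f: "e' i \<otimes> f = e' i" if "i < n" for i
        using e'g[OF that] that by (simp add: minus_eq r_distr r_minus e'e)
      define e'' where "e'' = e'(n := e)"
      have "finsum R e'' {..<Suc n} = e \<oplus> finsum R e' {..<n}"
      proof -
        have "finsum R e'' {..<n} = finsum R e' {..<n}"
          by (rule finsum_cong') (auto simp: e''_def)
        then show ?thesis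
          by (simp add: lessThan_Suc e''_def Pi_def)
      qed
      also have "\<dots> = e \<oplus> ?g"
        using d by (simp add: decomposes_def)
      also have "\<dots> = f"
        by (simp add: minus_eq a_lcomm[of e f] r_neg)
      finally have "finsum R e'' {..<Suc n} = f" .
      then have "decomposes f (Suc n) e''"
        using d e(2) e'e e'f ef
        by (auto simp: decomposes_def e''_def less_Suc_eq m_comm)
      then show ?thesis
        by blast
    qed
  qed
  obtain n e where "decomposes \<one> n e"
    using ex[of \<one>] by (auto simp: idempotent_elem_def)
  then show thesis
    by (intro that[of n e])
      (auto simp: decomposes_def complete_orthogonal_idempotents_def minimal_idempotent_def)
qed


section \<open>Division rings and local rings\<close>

lemma (in ring) Units_if_right_inverses:
  assumes ne: "\<one> \<noteq> \<zero>"
    and inv: "\<And>x. x \<in> carrier R \<Longrightarrow> x \<noteq> \<zero> \<Longrightarrow> \<exists>y \<in> carrier R. x \<otimes> y = \<one>"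
  shows "Units R = carrier R - {\<zero>}"
proof -
  have "x \<in> Units R" if x: "x \<in> carrier R" "x \<noteq> \<zero>" for x
  proof -
    obtain y where y: "y \<in> carrier R" "x \<otimes> y = \<one>"
      using inv x by blast
    then have "y \<noteq> \<zero>"
      using ne x by auto
    then obtain z where z: "z \<in> carrier R" "y \<otimes> z = \<one>"
      using inv y by blast
    have "x = x \<otimes> (y \<otimes> z)"
      using x z by simp
    also have "\<dots> = z"
      using x y z by (metis l_one m_assoc)
    finally show ?thesis
      using x y z unfolding Units_def by blast
  qed
  moreover have "\<zero> \<notin> Units R"
    using ne by (auto simp: Units_def)
  ultimately show ?thesis
    by (auto simp: Units_closed)
qed

lemma (in ring) cosets_eq_iff:
  assumes "ideal I R" "a \<in> carrier R" "b \<in> carrier R"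
  shows "I +> a = I +> b \<longleftrightarrow> a \<ominus> b \<in> I"
  using quotient_eq_iff_same_a_r_cos[OF assms] by simp

lemma (in ring) coset_eq_zero_iff:
  assumes "ideal I R" "a \<in> carrier R"
  shows "I +> a = \<zero>\<^bsub>R Quot I\<^esub> \<longleftrightarrow> a \<in> I"
  using assms ideal.rcos_const_imp_mem a_rcos_zero by (auto simp: FactRing_def)

lemma quotient_elem_cases:
  assumes "A \<in> carrier (R Quot I)"
  obtains x where "x \<in> carrier R" "A = I +>\<^bsub>R\<^esub> x"
  using assms by (auto simp: FactRing_simps)

text \<open>It suffices to invert on one side, because a right inverse of a nonzero element of the quotient
  is itself nonzero and so has a right inverse.\<close>
lemma (in ring) local_ringI:
  assumes "\<one> \<notin> jacobson_radical R"
    and inv: "\<And>x. x \<in> carrier R \<Longrightarrow> x \<notin> jacobson_radical R \<Longrightarrow>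
      \<exists>y \<in> carrier R. x \<otimes> y \<ominus> \<one> \<in> jacobson_radical R"
  shows "local_ring R"
proof -
  let ?J = "jacobson_radical R"
  interpret J: ideal ?J R
    by (rule jacobson_radical_ideal)
  interpret Q: ring "R Quot ?J"
    by (rule J.quotient_is_ring)
  interpret h: ring_hom_ring R "R Quot ?J" "(+>) ?J"
    by (rule J.rcos_ring_hom_ring)
  have ne: "\<one>\<^bsub>R Quot ?J\<^esub> \<noteq> \<zero>\<^bsub>R Quot ?J\<^esub>"
    using assms(1) coset_eq_zero_iff[OF jacobson_radical_ideal, of \<one>] h.hom_one by simp
  have "\<exists>B \<in> carrier (R Quot ?J). A \<otimes>\<^bsub>R Quot ?J\<^esub> B = \<one>\<^bsub>R Quot ?J\<^esub>"
    if A: "A \<in> carrier (R Quot ?J)" "A \<noteq> \<zero>\<^bsub>R Quot ?J\<^esub>" for A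
  proof -
    obtain x where x: "x \<in> carrier R" "A = ?J +> x"
      using A(1) by (rule quotient_elem_cases)
    then have "x \<notin> ?J"
      using A(2) coset_eq_zero_iff[OF jacobson_radical_ideal x(1)] by simp
    then obtain y where y: "y \<in> carrier R" "x \<otimes> y \<ominus> \<one> \<in> ?J"
      using inv x(1) by blast
    have "A \<otimes>\<^bsub>R Quot ?J\<^esub> (?J +> y) = ?J +> (x \<otimes> y)"
      using x y by simp
    also have "\<dots> = ?J +> \<one>"
      using x y cosets_eq_iff[OF jacobson_radical_ideal, of "x \<otimes> y" \<one>] by simp
    finally show ?thesis
      using h.hom_one h.hom_closed[OF y(1)] by auto
  qed
  then have "Units (R Quot ?J) = carrier (R Quot ?J) - {\<zero>\<^bsub>R Quot ?J\<^esub>}"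
    by (rule Q.Units_if_right_inverses[OF ne])
  then show ?thesis
    using ne by (intro local_ring.intro local_ring_axioms.intro division_ring.intro
        division_ring_axioms.intro ring_axioms Q.ring_axioms)
qed


section \<open>Corners at central idempotents\<close>

text \<open>For a central idempotent \<open>e\<close> this is the ring \<open>e R = e R e\<close> with identity \<open>e\<close>. The
  record is built from scratch so that the corner of a ring with additional record fields is still
  a plain ring.\<close>
definition corner :: "('a, 'b) ring_scheme \<Rightarrow> 'a \<Rightarrow> 'a ring"
  where "corner R e = \<lparr>carrier = (\<lambda>x. e \<otimes>\<^bsub>R\<^esub> x) ` carrier R, monoid.mult = (\<otimes>\<^bsub>R\<^esub>), one = e,
    ring.zero = \<zero>\<^bsub>R\<^esub>, add = (\<oplus>\<^bsub>R\<^esub>)\<rparr>"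

lemma corner_simps [simp]:
  "x \<otimes>\<^bsub>corner R e\<^esub> y = x \<otimes>\<^bsub>R\<^esub> y" "x \<oplus>\<^bsub>corner R e\<^esub> y = x \<oplus>\<^bsub>R\<^esub> y"
  "\<one>\<^bsub>corner R e\<^esub> = e" "\<zero>\<^bsub>corner R e\<^esub> = \<zero>\<^bsub>R\<^esub>"
  by (simp_all add: corner_def)

lemma (in ring) corner_carrier_iff:
  assumes "idempotent_elem R e"
  shows "x \<in> carrier (corner R e) \<longleftrightarrow> x \<in> carrier R \<and> e \<otimes> x = x"
proof
  have e: "e \<in> carrier R" "e \<otimes> e = e"
    using assms by (simp_all add: idempotent_elem_def)
  assume "x \<in> carrier (corner R e)"
  then obtain y where y: "y \<in> carrier R" "x = e \<otimes> y"
    by (auto simp: corner_def)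
  then have "e \<otimes> x = e \<otimes> e \<otimes> y"
    using e(1) by (simp add: m_assoc)
  then show "x \<in> carrier R \<and> e \<otimes> x = x"
    using e y by simp
next
  assume "x \<in> carrier R \<and> e \<otimes> x = x"
  then have "x = e \<otimes> x" "x \<in> carrier R"
    by simp_all
  then show "x \<in> carrier (corner R e)"
    unfolding corner_def by simp
qed

locale central_idempotent = ring +
  fixes e
  assumes central: "e \<in> center R" and idempotent: "idempotent_elem R e"
begin

lemma e_closed [simp]: "e \<in> carrier R" and e_idem [simp]: "e \<otimes> e = e"
  using idempotent by (simp_all add: idempotent_elem_def)

lemmas mem_corner = corner_carrier_iff[OF idempotent]

lemma e_commutes: "x \<in> carrier R \<Longrightarrow> x \<otimes> e = e \<otimes> x"
  using center_commutes[OF central] by simp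

lemma e_idem_left: "x \<in> carrier R \<Longrightarrow> e \<otimes> (e \<otimes> x) = e \<otimes> x"
  by (simp flip: m_assoc)

lemma e_times_in_corner: "x \<in> carrier R \<Longrightarrow> e \<otimes> x \<in> carrier (corner R e)"
  by (simp add: mem_corner e_idem_left)

lemma corner_ring: "ring (corner R e)"
proof (rule ringI)
  show "abelian_group (corner R e)"
  proof (rule abelian_groupI)
    show "\<exists>y \<in> carrier (corner R e). y \<oplus>\<^bsub>corner R e\<^esub> x = \<zero>\<^bsub>corner R e\<^esub>"
      if "x \<in> carrier (corner R e)" for x
      using that by (intro bexI[of _ "\<ominus> x"]) (simp_all add: mem_corner r_minus l_neg)
  qed (simp_all add: mem_corner r_distr a_ac)
  show "monoid (corner R e)"
    by (rule monoidI) (simp_all add: mem_corner e_commutes m_assoc flip: m_assoc[of e])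
qed (simp_all add: mem_corner l_distr r_distr)

lemma corner_minus:
  assumes "x \<in> carrier (corner R e)" "y \<in> carrier (corner R e)"
  shows "x \<ominus>\<^bsub>corner R e\<^esub> y = x \<ominus> y"
proof -
  interpret E: ring "corner R e"
    by (rule corner_ring)
  have "\<ominus>\<^bsub>corner R e\<^esub> y = \<ominus> y"
    using assms by (intro E.minus_equality) (simp_all add: mem_corner r_minus l_neg)
  then show ?thesis
    by (simp add: E.minus_eq minus_eq)
qed

lemma corner_hom: "(\<lambda>x. e \<otimes> x) \<in> ring_hom R (corner R e)"
proof (rule ring_hom_memI)
  fix x y assume xy: "x \<in> carrier R" "y \<in> carrier R"
  have "e \<otimes> x \<otimes> (e \<otimes> y) = e \<otimes> (x \<otimes> e) \<otimes> y"
    using xy by (simp add: m_assoc)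
  also have "\<dots> = e \<otimes> (x \<otimes> y)"
    using xy by (simp add: e_commutes e_idem_left) (simp add: m_assoc)
  finally show "e \<otimes> (x \<otimes> y) = e \<otimes> x \<otimes>\<^bsub>corner R e\<^esub> (e \<otimes> y)"
    by simp
qed (simp_all add: e_times_in_corner r_distr)

text \<open>A right inverse \<open>u\<close> of \<open>1 - x y\<close> in \<open>R\<close> gives the right inverse \<open>e u\<close> of
  \<open>e - x y\<close> in the corner. In the other direction, a right inverse \<open>u\<close> in the corner is extended
  by the identity on the complementary corner, to \<open>u + (1 - e)\<close>.\<close>
lemma corner_jacobson_radical:
  "jacobson_radical (corner R e) = jacobson_radical R \<inter> carrier (corner R e)"
proof -
  interpret E: ring "corner R e"
    by (rule corner_ring)
  have sub: "x \<ominus>\<^bsub>corner R e\<^esub> y = x \<ominus> y" "x \<in> carrier R"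
    if "x \<in> carrier (corner R e)" "y \<in> carrier (corner R e)" for x y
    using that corner_minus by (auto simp: mem_corner)
  have "x \<in> jacobson_radical (corner R e) \<longleftrightarrow> x \<in> jacobson_radical R"
    if x: "x \<in> carrier (corner R e)" for x
  proof
    have [simp]: "x \<in> carrier R" and ex: "e \<otimes> x = x"
      using x by (simp_all add: mem_corner)
    have xe: "x \<otimes> (e \<otimes> y) = x \<otimes> y" if "y \<in> carrier R" for y
      using that ex by (simp add: e_commutes flip: m_assoc)
    {
      assume J: "x \<in> jacobson_radical R"
      have "\<exists>u \<in> carrier (corner R e). (e \<ominus>\<^bsub>corner R e\<^esub> x \<otimes> y) \<otimes> u = e"
        if y: "y \<in> carrier (corner R e)" for y
      proof -
        have [simp]: "y \<in> carrier R"
          using y by (simp add: mem_corner)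
        obtain u where u: "u \<in> carrier R" "(\<one> \<ominus> x \<otimes> y) \<otimes> u = \<one>"
          using J \<open>y \<in> carrier R\<close> unfolding jacobson_radical_iff by blast
        have xy: "x \<otimes> y \<in> carrier (corner R e)"
          using x y E.m_closed by simp
        then have "e \<ominus>\<^bsub>corner R e\<^esub> x \<otimes> y = e \<otimes> (\<one> \<ominus> x \<otimes> y)"
          using E.one_closed by (simp add: corner_minus minus_eq r_distr r_minus mem_corner)
        then have "(e \<ominus>\<^bsub>corner R e\<^esub> x \<otimes> y) \<otimes> (e \<otimes> u) = e \<otimes> ((\<one> \<ominus> x \<otimes> y) \<otimes> u)"
          using ring_hom_mult[OF corner_hom, of "\<one> \<ominus> x \<otimes> y" u] u(1) by simp
        then show ?thesis
          using u e_times_in_corner by (intro bexI[of _ "e \<otimes> u"]) simp_all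
      qed
      then show "x \<in> jacobson_radical (corner R e)"
        using x by (simp add: E.jacobson_radical_iff)
    }
    assume J: "x \<in> jacobson_radical (corner R e)"
    have "\<exists>u \<in> carrier R. (\<one> \<ominus> x \<otimes> y) \<otimes> u = \<one>" if [simp]: "y \<in> carrier R" for y
    proof -
      have ey: "e \<otimes> y \<in> carrier (corner R e)"
        by (simp add: e_times_in_corner)
      then obtain u where u: "u \<in> carrier (corner R e)"
        "(e \<ominus>\<^bsub>corner R e\<^esub> x \<otimes> (e \<otimes> y)) \<otimes> u = e"
        using J unfolding E.jacobson_radical_iff corner_simps by blast
      have [simp]: "u \<in> carrier R" and eu: "e \<otimes> u = u"
        using u(1) by (simp_all add: mem_corner)
      have "x \<otimes> y \<in> carrier (corner R e)"
        using ex by (simp add: mem_corner flip: m_assoc)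
      then have eq: "(e \<ominus> x \<otimes> y) \<otimes> u = e"
        using u E.one_closed by (simp add: xe corner_minus)
      \<comment> \<open>On the complementary corner the factor \<open>1 - x y\<close> acts as the identity.\<close>
      have xe': "x \<otimes> y \<otimes> (\<one> \<ominus> e) = \<zero>"
        using ex by (simp add: minus_eq r_distr r_minus e_commutes r_neg flip: m_assoc)
      have ue: "u \<ominus> x \<otimes> y \<otimes> u = e"
        using eq eu by (simp add: minus_eq l_distr l_minus)
      have "(\<one> \<ominus> x \<otimes> y) \<otimes> (u \<oplus> (\<one> \<ominus> e))
          = u \<ominus> x \<otimes> y \<otimes> u \<oplus> ((\<one> \<ominus> e) \<ominus> x \<otimes> y \<otimes> (\<one> \<ominus> e))"
        by (simp add: minus_eq[of _ "x \<otimes> y"] minus_eq[of _ "x \<otimes> y \<otimes> _"] l_distr r_distr l_minus)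
      also note ue
      finally have "(\<one> \<ominus> x \<otimes> y) \<otimes> (u \<oplus> (\<one> \<ominus> e)) = \<one>"
        unfolding xe' by (simp add: minus_eq a_lcomm[of e \<one>] r_neg)
      then show ?thesis
        by (intro bexI[of _ "u \<oplus> (\<one> \<ominus> e)"]) simp_all
    qed
    then show "x \<in> jacobson_radical R"
      by (simp add: jacobson_radical_iff)
  qed
  moreover have "jacobson_radical (corner R e) \<subseteq> carrier (corner R e)"
    by (auto simp: jacobson_radical_def)
  ultimately show ?thesis
    by blast
qed

text \<open>If \<open>r c\<close> is a nonzero central multiple of \<open>r = e r\<close>, then \<open>e c\<close> is a multiplier in
  the corner with the same product.\<close>
lemma corner_centrally_essential:
  assumes "centrally_essential_ring R"
  shows "centrally_essential_ring (corner R e)"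
proof -
  interpret centrally_essential_ring R
    by fact
  interpret E: ring "corner R e"
    by (rule corner_ring)
  have center: "c \<in> center (corner R e)" if "c \<in> center R" "c \<in> carrier (corner R e)" for c
    using that center_commutes[OF that(1)] by (simp add: center_def mem_corner)
  have "\<exists>c \<in> center (corner R e). r \<otimes> c \<in> center (corner R e) - {\<zero>}"
    if r: "r \<in> carrier (corner R e)" "r \<noteq> \<zero>" for r
  proof -
    have [simp]: "r \<in> carrier R" and er: "e \<otimes> r = r"
      using r(1) by (simp_all add: mem_corner)
    obtain c where c: "c \<in> center R" "r \<otimes> c \<in> center R" "r \<otimes> c \<noteq> \<zero>"
      by (rule central_multiple[OF \<open>r \<in> carrier R\<close> r(2)])
    have [simp]: "c \<in> carrier R"
      using c(1) by (rule center_carrier)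
    have rec: "r \<otimes> (e \<otimes> c) = r \<otimes> c"
      using er by (simp add: e_commutes flip: m_assoc)
    have "e \<otimes> c \<in> center (corner R e)"
      using subcringE(6)[OF center_subcring central c(1)] e_times_in_corner[of c] center by simp
    moreover have "r \<otimes> c \<in> carrier (corner R e)"
      using er by (simp add: mem_corner flip: m_assoc)
    ultimately show ?thesis
      using c rec center by (intro bexI[of _ "e \<otimes> c"]) simp_all
  qed
  then show ?thesis
    unfolding E.centrally_essential_ring_iff by simp
qed

text \<open>The image of \<open>x = e x\<close> in the minimal right ideal generated by the coset of \<open>e\<close> is nonzero
  unless \<open>x\<close> is in the radical, and then generates that right ideal; this is invertibility of
  \<open>x\<close> modulo the radical of the corner.\<close>
lemma corner_local:
  assumes min: "minimal_idempotent (R Quot jacobson_radical R) (jacobson_radical R +> e)"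
  shows "local_ring (corner R e)"
proof -
  let ?J = "jacobson_radical R"
  let ?S = "R Quot ?J"
  note J = jacobson_radical_ideal
  interpret J: ideal ?J R
    by (rule J)
  interpret h: ring_hom_ring R ?S "(+>) ?J"
    by (rule J.rcos_ring_hom_ring)
  interpret E: ring "corner R e"
    by (rule corner_ring)
  note JE = corner_jacobson_radical
  show ?thesis
  proof (rule E.local_ringI)
    show "\<one>\<^bsub>corner R e\<^esub> \<notin> jacobson_radical (corner R e)"
      using min coset_eq_zero_iff[OF J, of e] by (simp add: JE minimal_idempotent_def)
    fix x assume x: "x \<in> carrier (corner R e)" "x \<notin> jacobson_radical (corner R e)"
    have [simp]: "x \<in> carrier R" and ex: "e \<otimes> x = x"
      using x(1) by (simp_all add: mem_corner)
    have ex': "(?J +> e) \<otimes>\<^bsub>?S\<^esub> (?J +> x) = ?J +> x"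
      using h.hom_mult[of e x] ex by simp
    have ne: "?J +> x \<noteq> \<zero>\<^bsub>?S\<^esub>"
      using x coset_eq_zero_iff[OF J, of x] by (simp add: JE)
    have inverses: "\<exists>B \<in> carrier ?S. (?J +> e) \<otimes>\<^bsub>?S\<^esub> A \<otimes>\<^bsub>?S\<^esub> B = ?J +> e"
      if "A \<in> carrier ?S" "(?J +> e) \<otimes>\<^bsub>?S\<^esub> A \<noteq> \<zero>\<^bsub>?S\<^esub>" for A
      using that min unfolding minimal_idempotent_def by blast
    obtain B where B: "B \<in> carrier ?S" "(?J +> x) \<otimes>\<^bsub>?S\<^esub> B = ?J +> e"
      using inverses[of "?J +> x"] ex' ne h.hom_closed[of x] by auto
    obtain y where [simp]: "y \<in> carrier R" and "B = ?J +> y"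
      using B(1) by (rule quotient_elem_cases)
    then have "?J +> (x \<otimes> y) = ?J +> e"
      using B(2) by simp
    then have "x \<otimes> y \<ominus> e \<in> ?J"
      using cosets_eq_iff[OF J, of "x \<otimes> y" e] by simp
    moreover have "x \<otimes> (e \<otimes> y) = x \<otimes> y"
      using ex by (simp add: e_commutes flip: m_assoc)
    moreover have xy: "x \<otimes> y \<in> carrier (corner R e)"
      using ex by (simp add: mem_corner flip: m_assoc)
    moreover have "x \<otimes> y \<ominus>\<^bsub>corner R e\<^esub> e = x \<otimes> y \<ominus> e"
      using corner_minus[OF xy] E.one_closed by simp
    moreover have "x \<otimes> y \<ominus>\<^bsub>corner R e\<^esub> e \<in> carrier (corner R e)"
      using xy E.one_closed E.minus_closed by simp
    ultimately show "\<exists>y \<in> carrier (corner R e).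
        x \<otimes>\<^bsub>corner R e\<^esub> y \<ominus>\<^bsub>corner R e\<^esub> \<one>\<^bsub>corner R e\<^esub> \<in> jacobson_radical (corner R e)"
      using e_times_in_corner[of y] by (intro bexI[of _ "e \<otimes> y"]) (simp_all add: JE)
  qed
qed

end

lemma (in cring) corner_field:
  assumes min: "minimal_idempotent R e"
  shows "field (corner R e)"
proof -
  have e: "idempotent_elem R e" "e \<noteq> \<zero>"
    and inv: "\<And>x. x \<in> carrier R \<Longrightarrow> e \<otimes> x \<noteq> \<zero> \<Longrightarrow> \<exists>y \<in> carrier R. e \<otimes> x \<otimes> y = e"
    using min by (auto simp: minimal_idempotent_def)
  interpret central_idempotent R e
    using e(1) by unfold_locales (auto simp: center_def idempotent_elem_def m_comm)
  interpret E: ring "corner R e"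
    by (rule corner_ring)
  interpret E: cring "corner R e"
    by unfold_locales (simp add: mem_corner m_comm)
  have "Units (corner R e) = carrier (corner R e) - {\<zero>\<^bsub>corner R e\<^esub>}"
  proof (rule E.Units_if_right_inverses)
    fix x assume x: "x \<in> carrier (corner R e)" "x \<noteq> \<zero>\<^bsub>corner R e\<^esub>"
    then have [simp]: "x \<in> carrier R" and ex: "e \<otimes> x = x"
      by (simp_all add: mem_corner)
    obtain y where y: "y \<in> carrier R" "x \<otimes> y = e"
      using inv[of x] x(2) ex by auto
    then have "x \<otimes> (e \<otimes> y) = e"
      using ex by (simp add: e_commutes flip: m_assoc)
    then show "\<exists>y \<in> carrier (corner R e). x \<otimes>\<^bsub>corner R e\<^esub> y = \<one>\<^bsub>corner R e\<^esub>"
      using e_times_in_corner[OF y(1)] by (intro bexI[of _ "e \<otimes> y"]) simp_all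
  qed (use e(2) in simp)
  then show ?thesis
    by (rule E.cring_fieldI)
qed

lemma ring_hom_into_RDirProd_list:
  assumes "\<And>i. i \<in> set ks \<Longrightarrow> h i \<in> ring_hom R (L i)"
  shows "(\<lambda>x. map (\<lambda>i. h i x) ks) \<in> ring_hom R (RDirProd_list (map L ks))"
  using assms
proof (induction ks)
  case Nil
  then show ?case
    by (auto simp: ring_hom_def monoid.defs)
next
  case (Cons k ks)
  then have "(\<lambda>x. (h k x, map (\<lambda>i. h i x) ks)) \<in> ring_hom R (RDirProd (L k) (RDirProd_list (map L ks)))"
    by (auto simp: ring_hom_def RDirProd_def DirProd_def monoid.defs)
  from ring_hom_trans[OF this RDirProd_list_hom1]
  show ?case
    by (simp add: comp_def)
qed

text \<open>The isomorphism sends \<open>x\<close> to the list of the \<open>e i x\<close>. It is injective because \<open>x\<close> is the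
  sum of these entries, and a list is the image of the sum of its entries by orthogonality.\<close>
lemma (in ring) product_of_corners:
  assumes complete: "complete_orthogonal_idempotents R n e"
    and central: "\<And>i. i < n \<Longrightarrow> e i \<in> center R"
  shows "R \<simeq> RDirProd_list (map (\<lambda>i. corner R (e i)) [0..<n])"
proof -
  have idem: "idempotent_elem R (e i)" if "i < n" for i
    using complete that by (simp add: complete_orthogonal_idempotents_def)
  have e [simp]: "e i \<in> carrier R" if "i < n" for i
    using idem[OF that] by (simp add: idempotent_elem_def)
  have orth: "e i \<otimes> e j = \<zero>" if "i < n" "j < n" "i \<noteq> j" for i j
    using complete that by (simp add: complete_orthogonal_idempotents_def)
  have sum: "finsum R e {..<n} = \<one>"
    using complete by (simp add: complete_orthogonal_idempotents_def)
  let ?L = "map (\<lambda>i. corner R (e i)) [0..<n]"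
  let ?h = "\<lambda>x. map (\<lambda>i. e i \<otimes> x) [0..<n]"
  have hom: "?h \<in> ring_hom R (RDirProd_list ?L)"
  proof (rule ring_hom_into_RDirProd_list)
    fix i assume "i \<in> set [0..<n]"
    then interpret central_idempotent R "e i"
      using idem central by unfold_locales auto
    show "(\<lambda>x. e i \<otimes> x) \<in> ring_hom R (corner R (e i))"
      by (rule corner_hom)
  qed
  have expand: "x = (\<Oplus>i\<in>{..<n}. e i \<otimes> x)" if "x \<in> carrier R" for x
    using finsum_ldistr[of "{..<n}" x e] that sum by (simp add: Pi_def)
  have "inj_on ?h (carrier R)"
  proof (rule inj_onI)
    fix x y assume xy: "x \<in> carrier R" "y \<in> carrier R" "?h x = ?h y"
    then have "e i \<otimes> x = e i \<otimes> y" if "i < n" for i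
      using that by auto
    then have "(\<Oplus>i\<in>{..<n}. e i \<otimes> x) = (\<Oplus>i\<in>{..<n}. e i \<otimes> y)"
      using xy by (intro finsum_cong') auto
    then show "x = y"
      using expand xy by metis
  qed
  moreover have "as \<in> ?h ` carrier R" if as: "as \<in> carrier (RDirProd_list ?L)" for as
  proof -
    have len: "length as = n"
      using RDirProd_list_carrier_mem(1)[OF as] by simp
    have "as ! i \<in> carrier (corner R (e i))" if "i < n" for i
      using RDirProd_list_carrier_mem(2)[OF as, of i] that by simp
    then have a [simp]: "as ! i \<in> carrier R" and ea: "e i \<otimes> as ! i = as ! i" if "i < n" for i
      using that corner_carrier_iff[OF idem] by blast+
    define x where "x = (\<Oplus>i\<in>{..<n}. as ! i)"
    have x: "x \<in> carrier R"
      by (simp add: x_def Pi_def)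
    have "e j \<otimes> x = as ! j" if j: "j < n" for j
    proof -
      have "e j \<otimes> x = (\<Oplus>i\<in>{..<n}. e j \<otimes> as ! i)"
        unfolding x_def using j by (intro finsum_rdistr) auto
      also have "\<dots> = (\<Oplus>i\<in>{..<n}. if j = i then as ! i else \<zero>)"
      proof (rule finsum_cong')
        fix i assume "i \<in> {..<n}"
        then have i: "i < n"
          by simp
        have "e j \<otimes> as ! i = e j \<otimes> e i \<otimes> as ! i"
          using i j ea[OF i] by (simp add: m_assoc)
        then show "e j \<otimes> as ! i = (if j = i then as ! i else \<zero>)"
          using i j ea[OF i] orth by auto
      qed auto
      also have "\<dots> = as ! j"
        using j by (intro finsum_singleton) auto
      finally show ?thesis .
    qed
    then have "?h x = as"
      using len by (intro nth_equalityI) auto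
    then show ?thesis
      using x by blast
  qed
  ultimately have "bij_betw ?h (carrier R) (carrier (RDirProd_list ?L))"
    using ring_hom_closed[OF hom] by (auto simp: bij_betw_def)
  then show ?thesis
    using hom by (auto simp: is_ring_iso_def ring_iso_def)
qed


section \<open>The quotient of a semiperfect centrally essential ring\<close>

lemma (in ring) right_inverse_modulo_radical:
  assumes w: "w \<in> carrier R" "w \<ominus> \<one> \<in> jacobson_radical R"
  shows "\<exists>v \<in> carrier R. w \<otimes> v = \<one>"
proof -
  have "\<one> \<ominus> (w \<ominus> \<one>) \<otimes> \<ominus> \<one> = w"
    using w(1) by (simp add: minus_eq r_minus a_lcomm[of \<one> w] r_neg)
  moreover have "\<exists>v \<in> carrier R. (\<one> \<ominus> (w \<ominus> \<one>) \<otimes> \<ominus> \<one>) \<otimes> v = \<one>"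
    using w(2) by (simp add: jacobson_radical_iff)
  ultimately show ?thesis
    by simp
qed

text \<open>A coset of \<open>x\<close> in the radical of \<open>R/J\<close> makes every \<open>1 - x y\<close> right invertible modulo
  \<open>J\<close>, hence right invertible in \<open>R\<close>, so \<open>x \<in> J\<close>.\<close>
lemma (in ring) jacobson_radical_quotient:
  "jacobson_radical (R Quot jacobson_radical R) = {\<zero>\<^bsub>R Quot jacobson_radical R\<^esub>}"
proof -
  let ?J = "jacobson_radical R"
  let ?S = "R Quot ?J"
  note J = jacobson_radical_ideal
  interpret J: ideal ?J R
    by (rule J)
  interpret S: ring ?S
    by (rule J.quotient_is_ring)
  interpret h: ring_hom_ring R ?S "(+>) ?J"
    by (rule J.rcos_ring_hom_ring)
  interpret JS: ideal "jacobson_radical ?S" ?S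
    by (rule S.jacobson_radical_ideal)
  have "jacobson_radical ?S \<subseteq> {\<zero>\<^bsub>?S\<^esub>}"
  proof
    fix A assume A: "A \<in> jacobson_radical ?S"
    have "A \<in> carrier ?S"
      using A by (simp add: jacobson_radical_def)
    then obtain x where [simp]: "x \<in> carrier R" and x: "A = ?J +> x"
      by (rule quotient_elem_cases)
    have quasi: "\<exists>U \<in> carrier ?S. (\<one>\<^bsub>?S\<^esub> \<ominus>\<^bsub>?S\<^esub> A \<otimes>\<^bsub>?S\<^esub> B) \<otimes>\<^bsub>?S\<^esub> U = \<one>\<^bsub>?S\<^esub>"
      if "B \<in> carrier ?S" for B
      using conjunct2[OF iffD1[OF S.jacobson_radical_iff A]] that by (rule bspec)
    have "\<exists>u \<in> carrier R. (\<one> \<ominus> x \<otimes> y) \<otimes> u = \<one>" if [simp]: "y \<in> carrier R" for y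
    proof -
      obtain U where U: "U \<in> carrier ?S" "(\<one>\<^bsub>?S\<^esub> \<ominus>\<^bsub>?S\<^esub> A \<otimes>\<^bsub>?S\<^esub> (?J +> y)) \<otimes>\<^bsub>?S\<^esub> U = \<one>\<^bsub>?S\<^esub>"
        using quasi[OF h.hom_closed[OF \<open>y \<in> carrier R\<close>]] by (rule bexE)
      obtain u where [simp]: "u \<in> carrier R" and u: "U = ?J +> u"
        using U(1) by (rule quotient_elem_cases)
      have "?J +> ((\<one> \<ominus> x \<otimes> y) \<otimes> u) = ?J +> \<one>"
        using U(2) by (simp add: x u minus_eq S.minus_eq)
      then have "(\<one> \<ominus> x \<otimes> y) \<otimes> u \<ominus> \<one> \<in> ?J"
        using cosets_eq_iff[OF J, of "(\<one> \<ominus> x \<otimes> y) \<otimes> u" \<one>] by simp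
      then have "\<exists>v \<in> carrier R. (\<one> \<ominus> x \<otimes> y) \<otimes> u \<otimes> v = \<one>"
        by (intro right_inverse_modulo_radical) simp_all
      then obtain v where v: "v \<in> carrier R" "(\<one> \<ominus> x \<otimes> y) \<otimes> u \<otimes> v = \<one>"
        by (rule bexE)
      then show ?thesis
        by (intro bexI[of _ "u \<otimes> v"]) (simp_all add: m_assoc)
    qed
    then have "x \<in> ?J"
      by (intro iffD2[OF jacobson_radical_iff] conjI ballI) simp_all
    then show "A \<in> {\<zero>\<^bsub>?S\<^esub>}"
      using coset_eq_zero_iff[OF J, of x] by (simp add: x)
  qed
  then show ?thesis
    using JS.zero_closed by (intro equalityI) simp_all
qed

text \<open>If \<open>a e = 0\<close>, then \<open>e\<close> is a central element with \<open>a e\<close> central, so \<open>k e = 0\<close> for the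
  commutator \<open>k = [a, b]\<close>. Otherwise \<open>a e\<close> has a nonzero central multiple \<open>a e c\<close>, so
  \<open>k e c = 0\<close>. An equation \<open>k e z = e\<close> then forces \<open>e = 0\<close> or \<open>e c = 0\<close>
  respectively.\<close>
lemma (in centrally_essential_ring) commutator_not_invertible_on_corner:
  assumes e: "idempotent_elem R e" "e \<noteq> \<zero>"
    and [simp]: "a \<in> carrier R" "b \<in> carrier R" "z \<in> carrier R"
  shows "(a \<otimes> b \<ominus> b \<otimes> a) \<otimes> e \<otimes> z \<noteq> e"
proof
  let ?k = "a \<otimes> b \<ominus> b \<otimes> a"
  assume inverse: "?k \<otimes> e \<otimes> z = e"
  have e_central: "e \<in> center R"
    using e(1) by (rule idempotent_central)
  then have [simp]: "e \<in> carrier R"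
    by (rule center_carrier)
  have ee: "e \<otimes> e = e"
    using e(1) by (simp add: idempotent_elem_def)
  show False
  proof (cases "a \<otimes> e = \<zero>")
    case True
    then have "?k \<otimes> e = \<zero>"
      using commutator_times_central[OF _ _ e_central] subcringE(2)[OF center_subcring] by simp
    then show False
      using inverse e(2) by simp
  next
    case False
    then obtain c where c: "c \<in> center R" "a \<otimes> e \<otimes> c \<in> center R" "a \<otimes> e \<otimes> c \<noteq> \<zero>"
      using central_multiple[of "a \<otimes> e"] by auto
    have [simp]: "c \<in> carrier R"
      using c(1) by (rule center_carrier)
    have "e \<otimes> c \<in> center R"
      using subcringE(6)[OF center_subcring e_central c(1)] .
    then have kec: "?k \<otimes> (e \<otimes> c) = \<zero>"
      using commutator_times_central[of a b "e \<otimes> c"] c(2) by (simp add: m_assoc)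
    have "e \<otimes> c = ?k \<otimes> e \<otimes> (z \<otimes> c)"
      using arg_cong[OF inverse, of "\<lambda>t. t \<otimes> c"] by (simp add: m_assoc)
    also have "\<dots> = ?k \<otimes> (e \<otimes> c) \<otimes> z"
      using center_commutes[OF c(1), of z] by (simp add: m_assoc)
    finally show False
      using c(3) kec by (simp add: m_assoc)
  qed
qed

text \<open>A commutator outside the radical has a multiple \<open>k y\<close> that is a nonzero idempotent modulo the
  radical. Lifting this idempotent to \<open>e\<close> and correcting \<open>k y\<close> by a right invertible factor
  makes \<open>k\<close> invertible on the corner of \<open>e\<close>.\<close>
lemma (in centrally_essential_ring) semiperfect_quotient_commutative:
  assumes "semiperfect_ring R"
  shows "cring (R Quot jacobson_radical R)"
proof -
  interpret semiperfect_ring R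
    by fact
  let ?J = "jacobson_radical R"
  let ?S = "R Quot ?J"
  note J = jacobson_radical_ideal
  interpret J: ideal ?J R
    by (rule J)
  interpret S: artinian_ring ?S
    by (rule quotient_artinian)
  interpret h: ring_hom_ring R ?S "(+>) ?J"
    by (rule J.rcos_ring_hom_ring)
  have "?J +> (a \<otimes> b) = ?J +> (b \<otimes> a)" if [simp]: "a \<in> carrier R" "b \<in> carrier R" for a b
  proof (rule ccontr)
    assume ne: "?J +> (a \<otimes> b) \<noteq> ?J +> (b \<otimes> a)"
    define k where "k = a \<otimes> b \<ominus> b \<otimes> a"
    have [simp]: "k \<in> carrier R"
      by (simp add: k_def)
    have "?J +> k \<noteq> \<zero>\<^bsub>?S\<^esub>"
      using ne cosets_eq_iff[OF J, of "a \<otimes> b" "b \<otimes> a"] coset_eq_zero_iff[OF J, of k]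
      by (simp add: k_def)
    let ?I = "(\<lambda>Y. (?J +> k) \<otimes>\<^bsub>?S\<^esub> Y) ` carrier ?S"
    have "(?J +> k) \<otimes>\<^bsub>?S\<^esub> \<one>\<^bsub>?S\<^esub> \<in> ?I"
      by blast
    then have "?I \<noteq> {\<zero>\<^bsub>?S\<^esub>}"
      using \<open>?J +> k \<noteq> \<zero>\<^bsub>?S\<^esub>\<close> by auto
    then obtain \<epsilon> where \<epsilon>: "\<epsilon> \<in> ?I" "minimal_idempotent ?S \<epsilon>"
      using S.minimal_idempotent_in_right_ideal[OF jacobson_radical_quotient
          S.principal_right_ideal[OF h.hom_closed[OF \<open>k \<in> carrier R\<close>]]] by metis
    then obtain Z where Z: "Z \<in> carrier ?S" "\<epsilon> = (?J +> k) \<otimes>\<^bsub>?S\<^esub> Z"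
      by blast
    obtain y where [simp]: "y \<in> carrier R" and "Z = ?J +> y"
      using Z(1) by (rule quotient_elem_cases)
    then have \<epsilon>_coset: "\<epsilon> = ?J +> (k \<otimes> y)"
      using Z(2) by simp
    have \<epsilon>_idem: "idempotent_elem ?S \<epsilon>" and "\<epsilon> \<noteq> \<zero>\<^bsub>?S\<^esub>"
      using \<epsilon>(2) by (simp_all add: minimal_idempotent_def)
    have [simp]: "\<epsilon> \<in> carrier ?S" and \<epsilon>\<epsilon>: "\<epsilon> \<otimes>\<^bsub>?S\<^esub> \<epsilon> = \<epsilon>"
      using \<epsilon>_idem by (simp_all add: idempotent_elem_def)
    \<comment> \<open>A single idempotent is lifted as a member of a complete system of two.\<close>
    let ?E = "\<lambda>i. if i = (0::nat) then \<epsilon> else \<one>\<^bsub>?S\<^esub> \<ominus>\<^bsub>?S\<^esub> \<epsilon>"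
    have "finsum ?S ?E {..<2} = \<one>\<^bsub>?S\<^esub>"
    proof -
      have "{..<2::nat} = {0, 1}"
        by auto
      then show ?thesis
        by (simp add: S.minus_eq S.a_lcomm[of \<epsilon> "\<one>\<^bsub>?S\<^esub>"] S.r_neg)
    qed
    then have "complete_orthogonal_idempotents ?S 2 ?E"
      using \<epsilon>_idem
      by (auto simp: complete_orthogonal_idempotents_def idempotent_elem_def S.minus_eq
          S.l_distr S.r_distr S.l_minus S.r_minus S.r_neg S.l_neg S.minus_zero)
    from idempotents_lift[OF this] obtain f where
      "complete_orthogonal_idempotents R 2 f" "?J +> f 0 = \<epsilon>"
      by auto
    define e where "e = f 0"
    have e: "idempotent_elem R e" "?J +> e = \<epsilon>"
      using \<open>complete_orthogonal_idempotents R 2 f\<close> \<open>?J +> f 0 = \<epsilon>\<close>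
      by (simp_all add: complete_orthogonal_idempotents_def e_def)
    have [simp]: "e \<in> carrier R" and ee: "e \<otimes> e = e"
      using e(1) by (simp_all add: idempotent_elem_def)
    have "e \<noteq> \<zero>"
      using e(2) \<open>\<epsilon> \<noteq> \<zero>\<^bsub>?S\<^esub>\<close> h.hom_zero by auto
    \<comment> \<open>Since \<open>k y\<close> is congruent to \<open>e\<close>, adding \<open>1 - e\<close> gives an element congruent to \<open>1\<close>.\<close>
    define w where "w = k \<otimes> y \<oplus> (\<one> \<ominus> e)"
    have [simp]: "w \<in> carrier R"
      by (simp add: w_def)
    have "k \<otimes> y \<ominus> e \<in> ?J"
      using cosets_eq_iff[OF J, of "k \<otimes> y" e] e(2) \<epsilon>_coset by simp
    moreover have "w \<ominus> \<one> = k \<otimes> y \<ominus> e"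
      by (simp add: w_def minus_eq a_assoc) (simp add: a_comm[of "\<ominus> e"] r_neg flip: a_assoc)
    ultimately obtain v where [simp]: "v \<in> carrier R" and v: "w \<otimes> v = \<one>"
      using right_inverse_modulo_radical[of w] by auto
    have e_comm: "e \<otimes> x = x \<otimes> e" if "x \<in> carrier R" for x
      using center_commutes[OF idempotent_central[OF e(1)] that] .
    have "e \<otimes> w = k \<otimes> e \<otimes> y"
      by (simp add: w_def minus_eq r_distr r_minus ee r_neg e_comm[of k] flip: m_assoc)
    then have "k \<otimes> e \<otimes> (y \<otimes> v) = e \<otimes> (w \<otimes> v)"
      by (simp flip: m_assoc)
    then have "k \<otimes> e \<otimes> (y \<otimes> v) = e"
      by (simp add: v)
    then show False
      using commutator_not_invertible_on_corner[OF e(1) \<open>e \<noteq> \<zero>\<close>, of a b "y \<otimes> v"]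
      by (simp add: k_def)
  qed
  then have "A \<otimes>\<^bsub>?S\<^esub> B = B \<otimes>\<^bsub>?S\<^esub> A" if "A \<in> carrier ?S" "B \<in> carrier ?S" for A B
  proof -
    obtain a b where "a \<in> carrier R" "A = ?J +> a" "b \<in> carrier R" "B = ?J +> b"
      using \<open>A \<in> carrier ?S\<close> \<open>B \<in> carrier ?S\<close> by (metis quotient_elem_cases)
    then show ?thesis
      using \<open>\<And>b a. \<lbrakk>a \<in> carrier R; b \<in> carrier R\<rbrakk> \<Longrightarrow> ?J +> (a \<otimes> b) = ?J +> (b \<otimes> a)\<close>[of a b]
      by simp
  qed
  then show ?thesis
    by (intro cring.intro comm_monoid.intro comm_monoid_axioms.intro S.ring_axioms S.monoid_axioms)
qed

text \<open>One complete system of idempotents serves both products: its members are minimal in the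
  quotient, and their lifts have local corners in \<open>R\<close>.\<close>
lemma (in centrally_essential_ring) semiperfect_decomposition:
  assumes "semiperfect_ring R"
  obtains Fs :: "'a set ring list" and Ls :: "'a ring list" where
    "\<And>F. F \<in> set Fs \<Longrightarrow> field F" "R Quot jacobson_radical R \<simeq> RDirProd_list Fs"
    "\<And>L. L \<in> set Ls \<Longrightarrow> centrally_essential_ring L \<and> local_ring L" "R \<simeq> RDirProd_list Ls"
proof -
  interpret semiperfect_ring R
    by fact
  let ?S = "R Quot jacobson_radical R"
  interpret S: artinian_ring ?S
    by (rule quotient_artinian)
  interpret S: cring ?S
    using assms by (rule semiperfect_quotient_commutative)
  obtain n e where e: "complete_orthogonal_idempotents ?S n e"
    "\<And>i. i < n \<Longrightarrow> minimal_idempotent ?S (e i)"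
    using S.minimal_idempotent_decomposition[OF jacobson_radical_quotient S.cring_axioms] by metis
  obtain f where f: "complete_orthogonal_idempotents R n f"
    "\<And>i. i < n \<Longrightarrow> jacobson_radical R +> f i = e i"
    using idempotents_lift[OF e(1)] by blast
  have f_idem: "idempotent_elem R (f i)" if "i < n" for i
    using f(1) that by (simp add: complete_orthogonal_idempotents_def)
  have "e i \<in> center ?S" if "i < n" for i
    using e(2)[OF that] by (auto simp: minimal_idempotent_def idempotent_elem_def center_def S.m_comm)
  then have "?S \<simeq> RDirProd_list (map (\<lambda>i. corner ?S (e i)) [0..<n])"
    using S.product_of_corners[OF e(1)] by simp
  moreover have "R \<simeq> RDirProd_list (map (\<lambda>i. corner R (f i)) [0..<n])"
    using product_of_corners[OF f(1)] idempotent_central f_idem by simp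
  moreover have "field (corner ?S (e i))" if "i < n" for i
    using S.corner_field e(2)[OF that] by simp
  moreover have "centrally_essential_ring (corner R (f i)) \<and> local_ring (corner R (f i))"
    if "i < n" for i
  proof -
    interpret central_idempotent R "f i"
      using f_idem[OF that] idempotent_central by unfold_locales auto
    show ?thesis
      using corner_centrally_essential[OF centrally_essential_ring_axioms] corner_local
        e(2)[OF that] f(2)[OF that] by simp
  qed
  ultimately show thesis
    by (intro that[of "map (\<lambda>i. corner ?S (e i)) [0..<n]" "map (\<lambda>i. corner R (f i)) [0..<n]"]) auto
qed

theorem theorem2:
  fixes R :: "('a, 'b) ring_scheme" (structure)
  assumes "centrally_essential_ring R"
  shows "(semiprime_ring (center_ring R) \<longrightarrow> cring R)
    \<and> (semiprime_ring R \<longrightarrow> cring R)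
    \<and> (\<forall>e. idempotent_elem R e \<longrightarrow> e \<in> center R)
    \<and> (semiperfect_ring R \<longrightarrow>
         (\<exists>Fs :: 'a set ring list.
            (\<forall>F \<in> set Fs. field F) \<and> R Quot jacobson_radical R \<simeq> RDirProd_list Fs)
       \<and> cring (R Quot jacobson_radical R)
       \<and> (\<exists>Ls :: 'a ring list.
            (\<forall>L \<in> set Ls. centrally_essential_ring L \<and> local_ring L) \<and> R \<simeq> RDirProd_list Ls)
       \<and> socle (center_ring R) (center_module R) \<subseteq> center R)"
proof -
  interpret centrally_essential_ring R
    by fact
  have 1: "cring R" if "semiprime_ring (center_ring R)"
  proof (rule cring_if_center_reduced)
    fix c assume "c \<in> center R" "c \<otimes> c = \<zero>"
    then show "c = \<zero>"
      using semiprime_ring.central_square_zero[OF that, of c] by (simp add: center_center_ring)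
  qed
  have 2: "cring R" if "semiprime_ring R"
    using cring_if_center_reduced semiprime_ring.central_square_zero[OF that] by blast
  have 4: "(\<exists>Fs :: 'a set ring list.
            (\<forall>F \<in> set Fs. field F) \<and> R Quot jacobson_radical R \<simeq> RDirProd_list Fs)
       \<and> (\<exists>Ls :: 'a ring list.
            (\<forall>L \<in> set Ls. centrally_essential_ring L \<and> local_ring L) \<and> R \<simeq> RDirProd_list Ls)"
    if "semiperfect_ring R"
    using semiperfect_decomposition[OF that] by metis
  show ?thesis
    using 1 2 4 idempotent_central semiperfect_quotient_commutative socle_subset_center by blast
qed

end
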